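(* Let $f,g\in C^2(0,\infty)$ with $f>0$, and let $r=g/f$. Let $X>0$ and let $h_{\rm ss}\in C^4(\mathbb R)$ be an $X$-periodic positive steady state of $h_t=-(f(h)h_{xxx})_x-(g(h)h_x)_x$. If $h_{\rm ss}$ is linearly unstable with respect to zero-mean perturbations at period $X$, then it is also energy unstable at period $X$. In particular, $h_{\rm ss}$ is energy unstable at period $X$ if it is non-constant and either (i) the least period of $h_{\rm ss}$ is $X/j$ for some integer $j\ge 2$, or (ii) $r$ is convex ($r''\ge 0$) and $r$ is non-constant on the range of $h_{\rm ss}$. For example, if $h_{\rm ss}$ is non-constant and $r''>0$, then $h_{\rm ss}$ is energy unstable in the directions $u=\pm h_{\rm ss}'$ and $u=\pm h_{\rm ss}''$.
   Context: $\mathbb T_X$ is the circle of circumference $X$; functions on $\mathbb T_X$ are identified with $X$-periodic functions on $\mathbb R$. A positive periodic steady state is a positive periodic function $h_{\rm ss}\in C^4$ satisfying $(f(h_{\rm ss})h_{\rm ss}'''+g(h_{\rm ss})h_{\rm ss}')'=0$ classically. Energy at period $X$: for positive $\ell\in H^1(\mathbb T_X)$, $\mathcal E(\ell)=\int_0^X\left[\tfrac12(\ell')^2-H(\ell)\right]dx$, where $H$ is a fixed function on $(0,\infty)$ with $H''=r=g/f$ (the choice of $H$ is immaterial when comparing functions of equal mean). For a mean-zero $X$-periodic function $u$, the steady state $h_{\rm ss}$ is energy unstable in the direction $u$ if $\mathcal E(h_{\rm ss}+\varepsilon u)<\mathcal E(h_{\rm ss})$ for all sufficiently small $\varepsilon>0$.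 It is energy unstable at period $X$ (with respect to zero-mean perturbations) if there is a smooth $X$-periodic $u$ with mean value zero such that $h_{\rm ss}$ is energy unstable in the direction $u$. Linear instability: $h_{\rm ss}$ is linearly unstable with respect to zero-mean perturbations at period $X$ if and only if $\tau_1(h_{\rm ss})<0$, where $$\tau_1(h_{\rm ss})=\min_u\frac{\int_0^X\left[(u')^2-r(h_{\rm ss})u^2\right]dx}{\int_0^X u^2\,dx},$$ the minimum being over nonzero $u\in H^1(\mathbb T_X)$ with $\int_0^X u\,dx=0$. (Take this as the definition.) *)

theory Defs
  imports "HOL-Analysis.Analysis" "HOL-Library.Periodic_Fun"
begin

text \<open>
  Differentiability on an open set. Derivatives at points of an open \<open>S\<close> depend only on the
  values of the function on \<open>S\<close>, so no assumption on its behaviour outside \<open>S\<close> is hidden here.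
\<close>

definition Ck_on :: "nat \<Rightarrow> real set \<Rightarrow> (real \<Rightarrow> real) \<Rightarrow> bool" where
  "Ck_on k S \<phi> \<longleftrightarrow>
     (\<forall>i<k. \<forall>x\<in>S. ((deriv ^^ i) \<phi>) differentiable (at x)) \<and> continuous_on S ((deriv ^^ k) \<phi>)"

definition smooth :: "(real \<Rightarrow> real) \<Rightarrow> bool" where
  "smooth \<phi> \<longleftrightarrow> (\<forall>k. Ck_on k UNIV \<phi>)"

definition least_period :: "(real \<Rightarrow> real) \<Rightarrow> real \<Rightarrow> bool" where
  "least_period \<phi> p \<longleftrightarrow>
     0 < p \<and> periodic_fun_simple \<phi> p \<and> (\<forall>q>0. periodic_fun_simple \<phi> q \<longrightarrow> p \<le> q)"

text \<open>
  Functions on the circle of circumference \<open>X\<close> are \<open>X\<close>-periodic functions on the line.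
  \<open>H1 X\<close> is the Sobolev space defined by weak derivatives, tested against smooth functions on the
  circle. Its elements are functions rather than classes modulo null sets; all integrals below
  are insensitive to the choice of representative.
\<close>

definition L2 :: "real \<Rightarrow> (real \<Rightarrow> real) set" where
  "L2 X = {u. periodic_fun_simple u X \<and> u \<in> borel_measurable lebesgue \<and>
              set_integrable lebesgue {0..X} (\<lambda>x. (u x)\<^sup>2)}"

definition is_weak_deriv :: "real \<Rightarrow> (real \<Rightarrow> real) \<Rightarrow> (real \<Rightarrow> real) \<Rightarrow> bool" where
  "is_weak_deriv X u v \<longleftrightarrow>
     (\<forall>\<phi>. smooth \<phi> \<and> periodic_fun_simple \<phi> X \<longrightarrow>
        (LINT x:{0..X}|lebesgue. u x * deriv \<phi> x) = - (LINT x:{0..X}|lebesgue. v x * \<phi> x))"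

definition H1 :: "real \<Rightarrow> (real \<Rightarrow> real) set" where
  "H1 X = {u \<in> L2 X. \<exists>v\<in>L2 X. is_weak_deriv X u v}"

text \<open>The weak derivative is determined up to a null set; an arbitrary representative is chosen.\<close>

definition weak_deriv :: "real \<Rightarrow> (real \<Rightarrow> real) \<Rightarrow> real \<Rightarrow> real" where
  "weak_deriv X u = (SOME v. v \<in> L2 X \<and> is_weak_deriv X u v)"

definition H1_mean_zero :: "real \<Rightarrow> (real \<Rightarrow> real) set" where
  "H1_mean_zero X = {u \<in> H1 X. (LINT x:{0..X}|lebesgue. u x) = 0}"

definition positive_steady_state ::
    "(real \<Rightarrow> real) \<Rightarrow> (real \<Rightarrow> real) \<Rightarrow> real \<Rightarrow> (real \<Rightarrow> real) \<Rightarrow> bool" where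
  "positive_steady_state f g X h \<longleftrightarrow>
     Ck_on 4 UNIV h \<and> periodic_fun_simple h X \<and> (\<forall>x. 0 < h x) \<and>
     (\<forall>x. ((\<lambda>y. f (h y) * (deriv ^^ 3) h y + g (h y) * deriv h y) has_real_derivative 0) (at x))"

text \<open>
  The Rayleigh quotients form a nonempty set that is bounded below and attains its infimum when
  \<open>r \<circ> h\<close> is continuous and periodic, so the infimum is the minimum. A nonzero element of \<open>H1 X\<close>
  is one that does not vanish almost everywhere.
\<close>

definition \<tau>\<^sub>1 :: "(real \<Rightarrow> real) \<Rightarrow> real \<Rightarrow> (real \<Rightarrow> real) \<Rightarrow> real" where
  "\<tau>\<^sub>1 r X h =
     (INF u \<in> {u \<in> H1_mean_zero X. \<not> (AE x in lebesgue. u x = 0)}.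
        (LINT x:{0..X}|lebesgue. (weak_deriv X u x)\<^sup>2 - r (h x) * (u x)\<^sup>2) /
        (LINT x:{0..X}|lebesgue. (u x)\<^sup>2))"

definition linearly_unstable :: "(real \<Rightarrow> real) \<Rightarrow> real \<Rightarrow> (real \<Rightarrow> real) \<Rightarrow> bool" where
  "linearly_unstable r X h \<longleftrightarrow> \<tau>\<^sub>1 r X h < 0"

definition energy :: "(real \<Rightarrow> real) \<Rightarrow> real \<Rightarrow> (real \<Rightarrow> real) \<Rightarrow> real" where
  "energy H X l = (LINT x:{0..X}|lebesgue. (weak_deriv X l x)\<^sup>2 / 2 - H (l x))"

text \<open>
  The energy is only meaningful for positive functions in \<open>H1 X\<close>, so the perturbed functions are
  required to be of this kind.
\<close>

definition energy_unstable_in_direction ::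
    "(real \<Rightarrow> real) \<Rightarrow> real \<Rightarrow> (real \<Rightarrow> real) \<Rightarrow> (real \<Rightarrow> real) \<Rightarrow> bool" where
  "energy_unstable_in_direction H X h u \<longleftrightarrow>
     u \<in> H1_mean_zero X \<and>
     (\<forall>\<^sub>F \<epsilon> in at_right 0. (\<forall>x. 0 < h x + \<epsilon> * u x) \<and>
        energy H X (\<lambda>x. h x + \<epsilon> * u x) < energy H X h)"

definition energy_unstable :: "(real \<Rightarrow> real) \<Rightarrow> real \<Rightarrow> (real \<Rightarrow> real) \<Rightarrow> bool" where
  "energy_unstable H X h \<longleftrightarrow> (\<exists>u. smooth u \<and> energy_unstable_in_direction H X h u)"

end

theory Submission
  imports Defs
begin

text \<open>
  Two integrations of the steady state equation give that \<open>h''' + r(h) h'\<close> vanishes and that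
  \<open>h'' + H'(h)\<close> is constant; periodicity kills the first constant of integration. Hence the energy
  has zero first variation in mean-zero directions \<open>u\<close>, and its second variation is the form
  \<open>\<integral> (u')\<^sup>2 - r(h) u\<^sup>2\<close>. A direction where the form is negative may be taken smooth: integrate
  a smooth function close to the weak derivative in \<open>L\<^sup>2\<close> and control the error by Poincare's
  inequality. If the form is only nonpositive at some \<open>u\<close>, it is still negative somewhere near \<open>u\<close>
  unless \<open>u\<close> is a critical point. This applies to \<open>h''\<close>, where the form equals
  \<open>-(1/3) \<integral> r''(h) (h')\<^sup>4\<close>, and, when \<open>h\<close> has several periods in \<open>X\<close>, to the difference of two
  translates of \<open>h'\<close> cut off outside a nodal interval. At \<open>h'\<close> the form and the third variation
  both vanish, and the strict convexity of \<open>r\<close> decides at fourth order.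
\<close>

subsection \<open>Smooth and periodic functions\<close>

text \<open>A minimiser of the form would satisfy an Euler-Lagrange equation with a multiplier for
  the mean constraint, but using it would call for compactness in \<open>H1 X\<close> and for
  regularity of minimisers. Instead criticality is refuted by an explicit test function
  \<open>w\<close>: if the form is at most zero at \<open>u\<close> and its bilinear version is
  nonzero at the pair of \<open>u\<close> and \<open>w\<close>, then it is negative at
  \<open>u + t * w\<close> for a suitable \<open>t\<close>. The function \<open>h'\<close> cannot
  play the role of \<open>u\<close>: it solves the linearised equation
  \<open>u'' + r(h) u = 0\<close>, so every pairing with it vanishes. Cutting it off at nodes
  destroys criticality at the price of corners, which is why weak derivatives with finitely many
  exceptional points are carried along. Restoring mean zero takes a second copy of the nodal piece
  with the opposite sign, hence two periods. In the convex case \<open>h''\<close> alone is not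
  enough, because the form vanishes there when \<open>r\<close> is affine on the range of
  \<open>h\<close>.\<close>

lemma Ck_on_0: "Ck_on 0 S f \<longleftrightarrow> continuous_on S f"
  by (simp add: Ck_on_def)

lemma Ck_on_Suc:
  "Ck_on (Suc k) S f \<longleftrightarrow> (\<forall>x\<in>S. f differentiable (at x)) \<and> Ck_on k S (deriv f)"
  unfolding Ck_on_def by (auto simp: All_less_Suc2 simp del: funpow.simps simp: funpow_Suc_right)

text \<open>Naming the derivative existentially lets the inductions on \<open>k\<close> below supply
  it explicitly, instead of computing iterates of \<open>deriv\<close>.\<close>

lemma Ck_on_Suc_has_derivative:
  "Ck_on (Suc k) UNIV f \<longleftrightarrow> (\<exists>f'. (\<forall>x. (f has_real_derivative f' x) (at x)) \<and> Ck_on k UNIV f')"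
proof
  assume "Ck_on (Suc k) UNIV f"
  then show "\<exists>f'. (\<forall>x. (f has_real_derivative f' x) (at x)) \<and> Ck_on k UNIV f'"
    unfolding Ck_on_Suc
    by (intro exI[of _ "deriv f"]) (auto simp: DERIV_deriv_iff_real_differentiable)
next
  assume "\<exists>f'. (\<forall>x. (f has_real_derivative f' x) (at x)) \<and> Ck_on k UNIV f'"
  then obtain f' where f': "\<And>x. (f has_real_derivative f' x) (at x)" "Ck_on k UNIV f'" by blast
  then have "deriv f = f'" by (auto intro: DERIV_imp_deriv)
  then show "Ck_on (Suc k) UNIV f"
    unfolding Ck_on_Suc using f' real_differentiable_def by auto
qed

lemma Ck_on_UNIV_SucD: "Ck_on (Suc k) UNIV f \<Longrightarrow> Ck_on k UNIV f"
proof (induction k arbitrary: f)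
  case 0
  then show ?case
    unfolding Ck_on_Suc Ck_on_0
    using differentiable_imp_continuous_on differentiable_on_def by blast
next
  case (Suc k)
  then show ?case by (metis Ck_on_Suc)
qed

lemma Ck_on_UNIV_add: "Ck_on k UNIV f \<Longrightarrow> Ck_on k UNIV g \<Longrightarrow> Ck_on k UNIV (\<lambda>x. f x + g x)"
proof (induction k arbitrary: f g)
  case 0
  then show ?case by (auto simp: Ck_on_0 intro: continuous_intros)
next
  case (Suc k)
  from Suc.prems obtain f' g' where
    "\<And>x. (f has_real_derivative f' x) (at x)" "Ck_on k UNIV f'"
    "\<And>x. (g has_real_derivative g' x) (at x)" "Ck_on k UNIV g'"
    unfolding Ck_on_Suc_has_derivative by blast
  then show ?case
    unfolding Ck_on_Suc_has_derivative
    by (intro exI[of _ "\<lambda>x. f' x + g' x"]) (auto intro: Suc.IH DERIV_add)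
qed

lemma Ck_on_UNIV_mult: "Ck_on k UNIV f \<Longrightarrow> Ck_on k UNIV g \<Longrightarrow> Ck_on k UNIV (\<lambda>x. f x * g x)"
proof (induction k arbitrary: f g)
  case 0
  then show ?case by (auto simp: Ck_on_0 intro: continuous_intros)
next
  case (Suc k)
  from Suc.prems obtain f' g' where
    f': "\<And>x. (f has_real_derivative f' x) (at x)" "Ck_on k UNIV f'" and
    g': "\<And>x. (g has_real_derivative g' x) (at x)" "Ck_on k UNIV g'"
    unfolding Ck_on_Suc_has_derivative by blast
  have "Ck_on k UNIV (\<lambda>x. f' x * g x + f x * g' x)"
    using Suc.prems[THEN Ck_on_UNIV_SucD] f' g' by (intro Ck_on_UNIV_add Suc.IH)
  then show ?case
    unfolding Ck_on_Suc_has_derivative using f'(1) g'(1)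
    by (intro exI[of _ "\<lambda>x. f' x * g x + f x * g' x"]) (auto intro!: derivative_eq_intros)
qed

lemma Ck_on_UNIV_const: "Ck_on k UNIV (\<lambda>x. c)"
proof (induction k arbitrary: c)
  case (Suc k)
  then show ?case unfolding Ck_on_Suc_has_derivative by (intro exI[of _ "\<lambda>x. 0"]) auto
qed (simp add: Ck_on_0)

text \<open>The induction differentiates the function, so the family must be closed under
  differentiation: the cosine is written as a sine with phase advanced by \<open>pi/2\<close>, and
  amplitude and phase stay arbitrary.\<close>

lemma Ck_on_UNIV_sin: "Ck_on k UNIV (\<lambda>x. c * sin (a * x + b))"
proof (induction k arbitrary: c b)
  case (Suc k)
  have "((\<lambda>x. c * sin (a * x + b)) has_real_derivative (c * a) * sin (a * x + (b + pi/2))) (at x)"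
    for x
    unfolding add.assoc[symmetric] sin_add[of _ "pi/2"] by (auto intro!: derivative_eq_intros)
  with Suc show ?case
    unfolding Ck_on_Suc_has_derivative
    by (intro exI[of _ "\<lambda>x. (c * a) * sin (a * x + (b + pi/2))"]) blast
qed (auto simp: Ck_on_0 intro!: continuous_intros)

lemma smooth_add: "smooth f \<Longrightarrow> smooth g \<Longrightarrow> smooth (\<lambda>x. f x + g x)"
  by (simp add: smooth_def Ck_on_UNIV_add)

lemma smooth_mult: "smooth f \<Longrightarrow> smooth g \<Longrightarrow> smooth (\<lambda>x. f x * g x)"
  by (simp add: smooth_def Ck_on_UNIV_mult)

lemma smooth_const: "smooth (\<lambda>x. c)"
  by (simp add: smooth_def Ck_on_UNIV_const)

lemma smooth_diff: "smooth f \<Longrightarrow> smooth g \<Longrightarrow> smooth (\<lambda>x. f x - g x)"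
  using smooth_add[OF _ smooth_mult[OF smooth_const[of "-1"]]] by simp

lemma smooth_sin: "smooth (\<lambda>x. sin (a * x + b))"
  using Ck_on_UNIV_sin[of _ 1] by (simp add: smooth_def)

lemma smooth_cos: "smooth (\<lambda>x. cos (a * x + b))"
  using smooth_sin[of a "b + pi/2"] by (simp add: add.assoc[symmetric] sin_add)

lemma smooth_primitive:
  assumes "\<And>x. (f has_real_derivative f' x) (at x)" "smooth f'"
  shows "smooth f"
  unfolding smooth_def
proof
  fix k show "Ck_on k UNIV f"
    by (rule Ck_on_UNIV_SucD) (use assms in \<open>auto simp: smooth_def Ck_on_Suc_has_derivative\<close>)
qed

lemma smooth_has_deriv: "smooth f \<Longrightarrow> (f has_real_derivative deriv f x) (at x)"
  unfolding smooth_def using Ck_on_Suc[of 0 UNIV f]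
  by (simp add: DERIV_deriv_iff_real_differentiable)

lemma smooth_deriv: "smooth f \<Longrightarrow> smooth (deriv f)"
  unfolding smooth_def using Ck_on_Suc by blast

lemma smooth_continuous: "smooth f \<Longrightarrow> continuous_on S f"
  unfolding smooth_def using Ck_on_0 continuous_on_subset by blast

lemma smooth_shift:
  assumes "smooth f" shows "smooth (\<lambda>x. f (x + c))"
proof -
  have "Ck_on k UNIV (\<lambda>x. f (x + c))" if "Ck_on k UNIV f" for k f
    using that
  proof (induction k arbitrary: f)
    case 0
    then show ?case
      by (auto simp: Ck_on_0 intro!: continuous_on_compose2[of UNIV f] continuous_intros)
  next
    case (Suc k)
    then obtain f' where f': "\<And>x. (f has_real_derivative f' x) (at x)" "Ck_on k UNIV f'"
      unfolding Ck_on_Suc_has_derivative by blast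
    then show ?case
      unfolding Ck_on_Suc_has_derivative
      by (intro exI[of _ "\<lambda>x. f' (x + c)"]) (auto intro: Suc.IH DERIV_shift[THEN iffD1])
  qed
  with assms show ?thesis by (simp add: smooth_def)
qed

section \<open>Periodic functions, their primitives and translates\<close>

lemma periodic_funI: "(\<And>x. f (x + p) = f x) \<Longrightarrow> periodic_fun_simple f (p::real)"
  by unfold_locales

lemma periodic_funD: "periodic_fun_simple f p \<Longrightarrow> f (x + p) = f x"
  for f :: "real \<Rightarrow> 'b"
  unfolding periodic_fun_simple_def periodic_fun_def by simp

lemma periodic_deriv:
  assumes "periodic_fun_simple f p" "\<And>x. (f has_real_derivative f' x) (at x)"
  shows "periodic_fun_simple f' p"
proof (rule periodic_funI)
  fix x
  have "((\<lambda>y. f (y + p)) has_real_derivative f' (x + p)) (at x)"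
    using assms(2) by (rule DERIV_shift[THEN iffD1])
  then show "f' (x + p) = f' x"
    using assms periodic_funD[OF assms(1)] by (simp add: DERIV_unique)
qed

lemma periodic_reduce:
  assumes "0 < (p::real)"
  obtains y where "0 \<le> y" "y \<le> p" "\<And>f :: real \<Rightarrow> real. periodic_fun_simple f p \<Longrightarrow> f x = f y"
proof
  let ?n = "\<lfloor>x / p\<rfloor>"
  have "of_int ?n * p \<le> x" "x \<le> (of_int ?n + 1) * p"
    using assms by (simp_all add: pos_le_divide_eq[symmetric] pos_divide_le_eq[symmetric])
  then show "0 \<le> x - of_int ?n * p" "x - of_int ?n * p \<le> p"
    by (auto simp: algebra_simps)
  fix f :: "real \<Rightarrow> real" assume "periodic_fun_simple f p"
  then interpret periodic_fun_simple f p .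
  show "f x = f (x - of_int ?n * p)" by (simp add: minus_of_int)
qed

lemma continuous_antiderivative:
  fixes f :: "real \<Rightarrow> real"
  assumes "continuous_on UNIV f"
  obtains F where "\<And>x. (F has_real_derivative f x) (at x)"
proof -
  have "\<exists>F. \<forall>x. - \<infinity> < ereal x \<longrightarrow> ereal x < \<infinity> \<longrightarrow> (F has_vector_derivative f x) (at x)"
    by (rule einterval_antiderivative)
       (use assms in \<open>auto simp: continuous_on_eq_continuous_at\<close>)
  then show ?thesis
    using that by (auto simp: has_real_derivative_iff_has_vector_derivative)
qed

lemma FTC_has_integral:
  fixes F :: "real \<Rightarrow> real"
  assumes "a \<le> b" "\<And>x. (F has_real_derivative f x) (at x)"
  shows "(f has_integral F b - F a) {a..b}"
  using assms
  by (intro fundamental_theorem_of_calculus)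
     (auto simp: has_real_derivative_iff_has_vector_derivative[symmetric]
           intro: has_field_derivative_at_within)

lemma FTC_periodic:
  fixes F :: "real \<Rightarrow> real"
  assumes "0 \<le> X" "\<And>x. (F has_real_derivative f x) (at x)" "periodic_fun_simple F X"
  shows "(f has_integral 0) {0..X}"
  using FTC_has_integral[OF assms(1,2)] periodic_funD[OF assms(3), of 0] by simp

text \<open>The increment of an antiderivative over one period has derivative
  \<open>f (y + X) - f y\<close>, which is zero, so it does not depend on where the period
  starts.\<close>

lemma integral_periodic_shift:
  fixes f :: "real \<Rightarrow> real"
  assumes "0 \<le> X" "continuous_on UNIV f" "periodic_fun_simple f X"
  shows "integral {0..X} (\<lambda>x. f (x + c)) = integral {0..X} f"
proof -
  obtain F where F: "\<And>x. (F has_real_derivative f x) (at x)"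
    using continuous_antiderivative assms(2) by blast
  have "((\<lambda>y. F (y + X) - F y) has_real_derivative f (y + X) - f y) (at y)" for y
    by (intro DERIV_diff DERIV_shift[THEN iffD1] F)
  then have "((\<lambda>y. F (y + X) - F y) has_real_derivative 0) (at y)" for y
    using periodic_funD[OF assms(3)] by simp
  then have "F (c + X) - F c = F (0 + X) - F 0"
    by (intro DERIV_isconst_all) blast
  moreover have "integral {0..X} (\<lambda>x. f (x + c)) = F (X + c) - F (0 + c)"
    by (rule integral_unique, rule FTC_has_integral[where F = "\<lambda>x. F (x + c)"])
       (intro assms(1), rule DERIV_shift[THEN iffD1], rule F)
  moreover have "integral {0..X} f = F X - F 0"
    by (rule integral_unique, rule FTC_has_integral) (use assms(1) F in auto)
  ultimately show ?thesis by (simp add: add.commute)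
qed

subsection \<open>Square integrable functions\<close>

lemma set_lebesgue_integral_lebesgue_on:
  "(LINT x:{0..X}|lebesgue. f x) = integral\<^sup>L (lebesgue_on {0..X}) (f :: real \<Rightarrow> real)"
  for X :: real
  by (simp add: set_lebesgue_integral_def integral_restrict_space)

lemma set_integrable_lebesgue_on:
  "set_integrable lebesgue {0..X} f \<longleftrightarrow> integrable (lebesgue_on {0..X}) (f :: real \<Rightarrow> real)"
  for X :: real
  by (simp add: set_integrable_def integrable_restrict_space)

lemma continuous_integrable_lebesgue_on:
  "continuous_on {0..X} f \<Longrightarrow> integrable (lebesgue_on {0..X}) (f :: real \<Rightarrow> real)"
  for X :: real
  by (rule continuous_imp_integrable_real)

lemma continuous_measurable_lebesgue_on:
  "continuous_on {0..X} f \<Longrightarrow> f \<in> borel_measurable (lebesgue_on {0..X})"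
  for f :: "real \<Rightarrow> real" and X :: real
  by (rule continuous_imp_measurable_on_sets_lebesgue) auto

lemma continuous_lebesgue_on_eq_integral:
  "continuous_on {0..X} f \<Longrightarrow> integral\<^sup>L (lebesgue_on {0..X}) f = integral {0..X} f"
  for f :: "real \<Rightarrow> real" and X :: real
  by (rule lebesgue_integral_eq_integral[OF continuous_integrable_lebesgue_on]) auto

text \<open>In contrast to \<open>L2\<close>, only the restriction to one period matters: there is
  no periodicity, and measurability is asked on \<open>{0..X}\<close> alone. Truncations and cut-off
  functions therefore qualify without being extended.\<close>

definition square_integrable :: "real \<Rightarrow> (real \<Rightarrow> real) \<Rightarrow> bool" where
  "square_integrable X u \<longleftrightarrow>
     u \<in> borel_measurable (lebesgue_on {0..X}) \<and> integrable (lebesgue_on {0..X}) (\<lambda>x. (u x)\<^sup>2)"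

definition inprod :: "real \<Rightarrow> (real \<Rightarrow> real) \<Rightarrow> (real \<Rightarrow> real) \<Rightarrow> real" where
  "inprod X u v = integral\<^sup>L (lebesgue_on {0..X}) (\<lambda>x. u x * v x)"

definition L2norm :: "real \<Rightarrow> (real \<Rightarrow> real) \<Rightarrow> real" where
  "L2norm X u = sqrt (inprod X u u)"

context
  fixes X :: real
begin

lemma square_integrable_mult:
  assumes "square_integrable X u" "square_integrable X v"
  shows "integrable (lebesgue_on {0..X}) (\<lambda>x. u x * v x)"
proof (rule Bochner_Integration.integrable_bound)
  show "integrable (lebesgue_on {0..X}) (\<lambda>x. (u x)\<^sup>2 + (v x)\<^sup>2)"
    and "(\<lambda>x. u x * v x) \<in> borel_measurable (lebesgue_on {0..X})"
    using assms by (auto simp: square_integrable_def)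
  have "\<bar>a * b\<bar> \<le> a\<^sup>2 + b\<^sup>2" for a b :: real
  proof -
    have "2 * \<bar>a * b\<bar> \<le> a\<^sup>2 + b\<^sup>2"
      using sum_squares_bound[of "\<bar>a\<bar>" "\<bar>b\<bar>"] by (simp add: abs_mult)
    then show ?thesis using abs_ge_zero[of "a * b"] by linarith
  qed
  then show "AE x in lebesgue_on {0..X}. norm (u x * v x) \<le> norm ((u x)\<^sup>2 + (v x)\<^sup>2)"
    by simp
qed

lemma square_integrable_cmult: "square_integrable X u \<Longrightarrow> square_integrable X (\<lambda>x. c * u x)"
  by (auto simp: square_integrable_def power_mult_distrib)

lemma square_integrable_add:
  assumes "square_integrable X u" "square_integrable X v"
  shows "square_integrable X (\<lambda>x. u x + v x)"
proof -
  have "integrable (lebesgue_on {0..X}) (\<lambda>x. (u x)\<^sup>2 + (v x)\<^sup>2 + 2 * (u x * v x))"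
    using assms square_integrable_mult[OF assms] by (auto simp: square_integrable_def)
  with assms show ?thesis
    by (auto simp: square_integrable_def power2_sum mult.assoc)
qed

lemma square_integrable_diff:
  assumes "square_integrable X u" "square_integrable X v"
  shows "square_integrable X (\<lambda>x. u x - v x)"
  using square_integrable_add[OF assms(1) square_integrable_cmult[OF assms(2), of "-1"]] by simp

lemma square_integrable_continuous:
  "continuous_on {0..X} u \<Longrightarrow> square_integrable X u"
  unfolding square_integrable_def
  by (intro conjI continuous_measurable_lebesgue_on continuous_integrable_lebesgue_on
        continuous_intros)

lemma square_integrable_smooth: "smooth u \<Longrightarrow> square_integrable X u"
  by (intro square_integrable_continuous smooth_continuous)

lemma square_integrable_integrable:
  assumes "square_integrable X u" shows "integrable (lebesgue_on {0..X}) u"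
  using square_integrable_mult[OF assms square_integrable_smooth[OF smooth_const[of 1]]] by simp

lemma square_integrable_continuous_mult:
  assumes "continuous_on {0..X} q" "square_integrable X u"
  shows "square_integrable X (\<lambda>x. q x * u x)"
proof -
  have "bounded (q ` {0..X})"
    using assms(1) by (intro compact_imp_bounded compact_continuous_image) auto
  then obtain B where B: "\<And>x. x \<in> {0..X} \<Longrightarrow> \<bar>q x\<bar> \<le> B"
    unfolding bounded_iff by (metis imageI real_norm_def)
  have "integrable (lebesgue_on {0..X}) (\<lambda>x. (q x * u x)\<^sup>2)"
  proof (rule Bochner_Integration.integrable_bound)
    show "integrable (lebesgue_on {0..X}) (\<lambda>x. B\<^sup>2 * (u x)\<^sup>2)"
      using assms by (auto simp: square_integrable_def)
    show "(\<lambda>x. (q x * u x)\<^sup>2) \<in> borel_measurable (lebesgue_on {0..X})"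
      using assms continuous_measurable_lebesgue_on[OF assms(1)]
      by (auto simp: square_integrable_def)
    have "(q x * u x)\<^sup>2 \<le> B\<^sup>2 * (u x)\<^sup>2" if "x \<in> {0..X}" for x
      unfolding power_mult_distrib
      using power_mono[OF B[OF that], of 2] by (intro mult_right_mono) auto
    then show "AE x in lebesgue_on {0..X}. norm ((q x * u x)\<^sup>2) \<le> norm (B\<^sup>2 * (u x)\<^sup>2)"
      by (intro AE_I2) (simp add: space_restrict_space)
  qed
  with assms continuous_measurable_lebesgue_on[OF assms(1)] show ?thesis
    by (auto simp: square_integrable_def)
qed

lemma inprod_add:
  assumes "square_integrable X u" "square_integrable X v" "square_integrable X w"
  shows "inprod X (\<lambda>x. u x + v x) w = inprod X u w + inprod X v w"
  using square_integrable_mult[OF assms(1,3)] square_integrable_mult[OF assms(2,3)]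
  by (simp add: inprod_def distrib_right)

lemma inprod_diff:
  assumes "square_integrable X u" "square_integrable X v" "square_integrable X w"
  shows "inprod X (\<lambda>x. u x - v x) w = inprod X u w - inprod X v w"
  using square_integrable_mult[OF assms(1,3)] square_integrable_mult[OF assms(2,3)]
  by (simp add: inprod_def left_diff_distrib)

lemma inprod_cmult: "inprod X (\<lambda>x. c * u x) v = c * inprod X u v"
  by (simp add: inprod_def mult.assoc)

lemma inprod_commute: "inprod X u v = inprod X v u"
  by (simp add: inprod_def mult.commute)

lemma inprod_ge0: "0 \<le> inprod X u u"
  by (simp add: inprod_def)

lemma inprod_add_square:
  assumes "square_integrable X u" "square_integrable X v"
  shows "inprod X (\<lambda>x. u x + t * v x) (\<lambda>x. u x + t * v x) =
         inprod X u u + 2 * t * inprod X u v + t\<^sup>2 * inprod X v v"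
proof -
  have s: "square_integrable X (\<lambda>x. t * v x)" "square_integrable X (\<lambda>x. u x + t * v x)"
    using assms by (auto intro: square_integrable_cmult square_integrable_add)
  have r: "inprod X w (\<lambda>x. u x + t * v x) = inprod X u w + t * inprod X v w"
    if "square_integrable X w" for w
    using inprod_add[OF assms(1) s(1) that] inprod_commute inprod_cmult by metis
  show ?thesis
    unfolding inprod_add[OF assms(1) s(1) s(2)] r[OF assms(1)] r[OF assms(2)] inprod_cmult
    by (simp add: algebra_simps power2_eq_square inprod_commute[of v u])
qed

lemma L2norm_ge0: "0 \<le> L2norm X u"
  by (simp add: L2norm_def inprod_ge0)

lemma L2norm_power2: "(L2norm X u)\<^sup>2 = inprod X u u"
  by (simp add: L2norm_def inprod_ge0)

lemma L2norm_cmult: "L2norm X (\<lambda>x. c * u x) = \<bar>c\<bar> * L2norm X u"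
proof -
  have "inprod X (\<lambda>x. c * u x) (\<lambda>x. c * u x) = c\<^sup>2 * inprod X u u"
    by (metis inprod_cmult inprod_commute mult.assoc power2_eq_square)
  then show ?thesis by (simp add: L2norm_def real_sqrt_mult)
qed

text \<open>The squared norm of \<open>u + t * v\<close> is a quadratic polynomial in
  \<open>t\<close> that is never negative; evaluating it at its minimum \<open>t = - b / c\<close>
  gives the inequality. If \<open>c = 0\<close> the polynomial is affine, hence constant.\<close>

lemma inprod_Cauchy_Schwarz:
  assumes "square_integrable X u" "square_integrable X v"
  shows "\<bar>inprod X u v\<bar> \<le> L2norm X u * L2norm X v"
proof -
  let ?a = "inprod X u u" and ?b = "inprod X u v" and ?c = "inprod X v v"
  have nn: "0 \<le> ?a + 2 * t * ?b + t\<^sup>2 * ?c" for t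
    using inprod_ge0[of "\<lambda>x. u x + t * v x"] unfolding inprod_add_square[OF assms] .
  have "?b\<^sup>2 \<le> ?a * ?c"
  proof (cases "?c = 0")
    case True
    have "?b = 0"
    proof (rule ccontr)
      assume "?b \<noteq> 0"
      \<comment> \<open>At this \<open>t\<close> the affine polynomial takes the value
        \<open>-1\<close>.\<close>
      then show False
        using nn[of "- (?a + 1) / (2 * ?b)"] True by (simp add: field_simps)
    qed
    then show ?thesis using True by simp
  next
    case False
    then have "0 < ?c" using inprod_ge0[of v] by simp
    then show ?thesis
      using nn[of "- ?b / ?c"] by (simp add: field_simps power2_eq_square)
  qed
  then have "\<bar>?b\<bar> \<le> sqrt (?a * ?c)"
    using real_le_rsqrt[of "\<bar>?b\<bar>"] by simp
  then show ?thesis by (simp add: L2norm_def real_sqrt_mult)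
qed

lemma L2norm_triangle:
  assumes "square_integrable X u" "square_integrable X v"
  shows "L2norm X (\<lambda>x. u x + v x) \<le> L2norm X u + L2norm X v"
proof (rule power2_le_imp_le)
  show "(L2norm X (\<lambda>x. u x + v x))\<^sup>2 \<le> (L2norm X u + L2norm X v)\<^sup>2"
    using inprod_Cauchy_Schwarz[OF assms] inprod_add_square[OF assms, of 1]
    by (simp add: L2norm_power2 power2_sum)
qed (simp add: L2norm_ge0)

lemma L2norm_triangle_diff:
  assumes "square_integrable X u" "square_integrable X v" "square_integrable X w"
  shows "L2norm X (\<lambda>x. u x - w x) \<le> L2norm X (\<lambda>x. u x - v x) + L2norm X (\<lambda>x. v x - w x)"
  using L2norm_triangle[OF square_integrable_diff[OF assms(1,2)] square_integrable_diff[OF assms(2,3)]]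
  by simp

lemma L2norm_minus_commute: "L2norm X (\<lambda>x. u x - v x) = L2norm X (\<lambda>x. v x - u x)"
  using L2norm_cmult[of "-1" "\<lambda>x. u x - v x"] by simp

end

subsection \<open>Density of the smooth periodic functions\<close>

text \<open>Dominated convergence for the squared error, with majorant \<open>2 v^2 + 2 w^2\<close>.
  It serves three times in \<open>L2_smooth_dense\<close>, with \<open>w\<close> being either the
  function itself or a constant.\<close>

lemma L2_dominated_approximation:
  fixes X :: real
  assumes "square_integrable X v" "\<And>n. s n \<in> borel_measurable (lebesgue_on {0..X})"
    and "square_integrable X w" "\<And>n x. x \<in> {0..X} \<Longrightarrow> \<bar>s n x\<bar> \<le> \<bar>w x\<bar>"
    and "AE x in lebesgue_on {0..X}. (\<lambda>n. s n x) \<longlonglongrightarrow> v x" and "0 < e"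
  obtains n where "square_integrable X (s n)" "L2norm X (\<lambda>x. v x - s n x) < e"
proof -
  let ?M = "lebesgue_on {0..X}"
  have [measurable]: "v \<in> borel_measurable ?M" "\<And>n. s n \<in> borel_measurable ?M"
    using assms by (auto simp: square_integrable_def)
  have sq: "square_integrable X (s n)" for n
  proof -
    have "integrable ?M (\<lambda>x. (s n x)\<^sup>2)"
    proof (rule Bochner_Integration.integrable_bound)
      show "integrable ?M (\<lambda>x. (w x)\<^sup>2)" using assms by (simp add: square_integrable_def)
      show "AE x in ?M. norm ((s n x)\<^sup>2) \<le> norm ((w x)\<^sup>2)"
        using assms(4) by (intro AE_I2) (simp add: space_restrict_space abs_le_square_iff)
    qed simp
    then show ?thesis by (simp add: square_integrable_def)
  qed
  have "(\<lambda>n. integral\<^sup>L ?M (\<lambda>x. (v x - s n x)\<^sup>2)) \<longlonglongrightarrow> integral\<^sup>L ?M (\<lambda>x. 0)"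
  proof (rule integral_dominated_convergence)
    show "integrable ?M (\<lambda>x. 2 * (v x)\<^sup>2 + 2 * (w x)\<^sup>2)"
      using assms by (auto simp: square_integrable_def)
    show "AE x in ?M. (\<lambda>n. (v x - s n x)\<^sup>2) \<longlonglongrightarrow> 0"
      using assms(5)
    proof eventually_elim
      case (elim x)
      then have "(\<lambda>n. (v x - s n x)\<^sup>2) \<longlonglongrightarrow> (v x - v x)\<^sup>2" by (intro tendsto_intros)
      then show ?case by simp
    qed
    show "AE x in ?M. norm ((v x - s n x)\<^sup>2) \<le> 2 * (v x)\<^sup>2 + 2 * (w x)\<^sup>2" for n
    proof (rule AE_I2)
      fix x assume "x \<in> space ?M"
      then have "(s n x)\<^sup>2 \<le> (w x)\<^sup>2"
        using assms(4) by (simp add: space_restrict_space abs_le_square_iff)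
      moreover have "(v x - s n x)\<^sup>2 \<le> 2 * (v x)\<^sup>2 + 2 * (s n x)\<^sup>2"
        using sum_squares_ge_zero[of "v x + s n x" 0] by (simp add: power2_eq_square algebra_simps)
      ultimately show "norm ((v x - s n x)\<^sup>2) \<le> 2 * (v x)\<^sup>2 + 2 * (w x)\<^sup>2" by simp
    qed
  qed simp_all
  then have "(\<lambda>n. (L2norm X (\<lambda>x. v x - s n x))\<^sup>2) \<longlonglongrightarrow> 0"
    unfolding L2norm_power2 inprod_def by (simp add: power2_eq_square)
  from order_tendstoD(2)[OF this, of "e\<^sup>2"] \<open>0 < e\<close>
  obtain n where "(L2norm X (\<lambda>x. v x - s n x))\<^sup>2 < e\<^sup>2"
    using eventually_sequentially by auto
  then have "L2norm X (\<lambda>x. v x - s n x) < e"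
    by (rule power2_less_imp_less) (use \<open>0 < e\<close> in auto)
  with sq that show ?thesis by blast
qed

text \<open>On the unit circle a real-linear functional of the plane is a combination of cosine and
  sine, so polynomials in such functionals become trigonometric polynomials.\<close>

lemma smooth_circle_polynomial:
  assumes "real_polynomial_function (p :: complex \<Rightarrow> real)"
  shows "smooth (\<lambda>x. p (cis (a * x)))"
  using assms
proof induction
  case (linear f)
  then interpret bounded_linear f .
  have "f (cis (a * x)) = cos (a * x + 0) * f 1 + sin (a * x + 0) * f \<i>" for x
  proof -
    have "cis (a * x) = cos (a * x) *\<^sub>R 1 + sin (a * x) *\<^sub>R \<i>"
      by (simp add: complex_eq_iff)
    then show ?thesis by (simp add: add scaleR)
  qed
  then show ?case
    by (simp only:) (intro smooth_add smooth_mult smooth_cos smooth_sin smooth_const)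
qed (auto intro: smooth_const smooth_add smooth_mult)

text \<open>This is Weierstrass's theorem for trigonometric polynomials: transport \<open>g\<close>
  to the unit circle, approximate it there by a polynomial in two real variables, and pull back
  along \<open>cis\<close>.\<close>

lemma uniform_smooth_approximation:
  fixes g :: "real \<Rightarrow> real"
  assumes "0 < X" "continuous_on {0..X} g" "g 0 = g X" "0 < e"
  obtains p where "smooth p" "periodic_fun_simple p X" "\<And>x. x \<in> {0..X} \<Longrightarrow> \<bar>g x - p x\<bar> < e"
proof -
  define \<gamma> where "\<gamma> = (\<lambda>t. complex_of_real (g (X * t)))"
  have "path \<gamma>"
    unfolding path_def \<gamma>_def using assms(1)
    by (intro continuous_intros continuous_on_compose2[OF assms(2)]) (auto simp: mult_le_cancel_left2)
  \<comment> \<open>The constant homotopy of the loop is only a device: it yields continuity of the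
    transported function on the whole circle, including the point \<open>1\<close> where
    \<open>Arg2pi\<close> jumps.\<close>
  then have "homotopic_loops UNIV \<gamma> \<gamma>"
    using assms by (simp add: homotopic_loops_refl pathstart_def pathfinish_def \<gamma>_def)
  then have "continuous_on (sphere 0 1) (\<gamma> \<circ> (\<lambda>z. Arg2pi z / (2 * pi)))"
    using homotopic_loops_imp_homotopic_circlemaps homotopic_with_imp_continuous by blast
  then have "continuous_on (sphere 0 1) (\<lambda>z. Re (\<gamma> (Arg2pi z / (2 * pi))))"
    unfolding o_def by (intro continuous_intros)
  then obtain p where p: "real_polynomial_function p"
      "\<And>z. z \<in> sphere 0 1 \<Longrightarrow> \<bar>Re (\<gamma> (Arg2pi z / (2 * pi))) - p z\<bar> < e"
    using Stone_Weierstrass_real_polynomial_function[OF compact_sphere _ \<open>0 < e\<close>] by blast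
  define a where "a = 2 * pi / X"
  have "0 < a" using assms(1) by (simp add: a_def)
  have a: "a * X = 2 * pi" using assms(1) by (simp add: a_def)
  show ?thesis
  proof
    show "smooth (\<lambda>x. p (cis (a * x)))" using p(1) by (rule smooth_circle_polynomial)
    have "cis (a * (x + X)) = cis (a * x)" for x
      by (simp add: distrib_left a complex_eq_iff)
    then show "periodic_fun_simple (\<lambda>x. p (cis (a * x))) X"
      by (intro periodic_funI) simp
    fix x assume x: "x \<in> {0..X}"
    have "g x = Re (\<gamma> (Arg2pi (cis (a * x)) / (2 * pi)))"
    \<comment> \<open>At \<open>x = X\<close> the argument has wrapped around to 0, and the value is
      recovered from \<open>g 0 = g X\<close>.\<close>
    proof (cases "x = X")
      case True
      then have "cis (a * x) = 1" by (simp add: a complex_eq_iff)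
      then show ?thesis using assms(3) True Arg2pi_of_real[of 1] by (simp add: \<gamma>_def)
    next
      case False
      then have "a * x < a * X" "0 \<le> a * x"
        using \<open>0 < a\<close> x by auto
      then have "Arg2pi (cis (a * x)) = a * x"
        by (intro Arg2pi_unique[of 1]) (auto simp: cis_conv_exp a)
      then show ?thesis using assms(1) by (simp add: \<gamma>_def a_def)
    qed
    then show "\<bar>g x - p (cis (a * x))\<bar> < e" using p(2)[of "cis (a * x)"] by simp
  qed
qed

lemma L2norm_bound:
  assumes "0 \<le> X" "square_integrable X u" "\<And>x. x \<in> {0..X} \<Longrightarrow> \<bar>u x\<bar> \<le> e"
  shows "L2norm X u \<le> e * sqrt X"
proof -
  have "0 \<le> e" using assms(1) assms(3)[of 0] by simp
  have "integral\<^sup>L (lebesgue_on {0..X}) (\<lambda>x. (u x)\<^sup>2) \<le> integral\<^sup>L (lebesgue_on {0..X}) (\<lambda>x. e\<^sup>2)"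
  proof (rule integral_mono)
    show "integrable (lebesgue_on {0..X}) (\<lambda>x. (u x)\<^sup>2)" using assms by (simp add: square_integrable_def)
    show "integrable (lebesgue_on {0..X}) (\<lambda>x. e\<^sup>2)" by (intro continuous_integrable_lebesgue_on) simp
    show "(u x)\<^sup>2 \<le> e\<^sup>2" if "x \<in> space (lebesgue_on {0..X})" for x
      using power_mono[OF assms(3)[of x], of 2] that by (simp add: space_restrict_space)
  qed
  also have "\<dots> = e\<^sup>2 * X"
    using assms(1) by (subst continuous_lebesgue_on_eq_integral) auto
  also have "\<dots> = (e * sqrt X)\<^sup>2"
    using assms(1) by (simp add: power_mult_distrib)
  finally have "(L2norm X u)\<^sup>2 \<le> (e * sqrt X)\<^sup>2"
    unfolding L2norm_power2 inprod_def by (simp only: power2_eq_square)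
  then show ?thesis by (rule power2_le_imp_le) (use \<open>0 \<le> e\<close> assms(1) in auto)
qed

text \<open>The error is split into four quarters: truncation of the values, approximation by
  continuous functions, a cut-off at the ends of the period, and uniform approximation by a smooth
  periodic function.\<close>

lemma L2_smooth_dense:
  assumes "0 < X" "square_integrable X v" "0 < e"
  obtains p where "smooth p" "periodic_fun_simple p X" "L2norm X (\<lambda>x. v x - p x) < e"
proof -
  let ?M = "lebesgue_on {0..X}"
  have [measurable]: "v \<in> borel_measurable ?M" using assms by (simp add: square_integrable_def)
  define clamp where "clamp = (\<lambda>(B::real) y. max (-B) (min B y))"
  have clamp: "\<bar>clamp B y\<bar> \<le> B" "\<bar>clamp B y\<bar> \<le> \<bar>y\<bar>" if "0 \<le> B" for B y
    using that by (auto simp: clamp_def)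
  have clamp_lim: "(\<lambda>n. clamp (real n) y) \<longlonglongrightarrow> y" for y
  proof (rule tendsto_eventually)
    obtain N where N: "\<bar>y\<bar> \<le> real N" using real_arch_simple by blast
    show "\<forall>\<^sub>F n in sequentially. clamp (real n) y = y"
      using eventually_ge_at_top[of N]
    proof eventually_elim
      case (elim n)
      then have "\<bar>y\<bar> \<le> real n" using N by linarith
      then show ?case by (auto simp: clamp_def)
    qed
  qed
  obtain n where n: "square_integrable X (\<lambda>x. clamp (real n) (v x))"
      "L2norm X (\<lambda>x. v x - clamp (real n) (v x)) < e / 4"
  proof (rule L2_dominated_approximation[of X v "\<lambda>n x. clamp (real n) (v x)" v "e / 4"])
    show "(\<lambda>x. clamp (real n) (v x)) \<in> borel_measurable ?M" for n
      by (simp add: clamp_def)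
  qed (use assms clamp clamp_lim in auto)
  define B where "B = real n"
  have "0 \<le> B" by (simp add: B_def)
  have const: "square_integrable X (\<lambda>x. B)" by (intro square_integrable_continuous) simp
  \<comment> \<open>\<open>measurable_on\<close> supplies continuous functions converging almost
    everywhere, but with no bound. Clamping them at the level \<open>B\<close> of the truncated
    target gives the constant majorant that dominated convergence needs.\<close>
  obtain N g where g: "negligible N" "\<And>n. continuous_on UNIV (g n)"
      "\<And>x. x \<notin> N \<Longrightarrow> (\<lambda>n. g n x) \<longlonglongrightarrow> (if x \<in> {0..X} then v x else 0)"
  proof -
    have "v measurable_on {0..X}"
      by (simp add: measurable_on_iff_borel_measurable)
    then show ?thesis using that unfolding measurable_on_def by blast
  qed
  obtain m where m: "square_integrable X (\<lambda>x. clamp B (g m x))"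
      "L2norm X (\<lambda>x. clamp B (v x) - clamp B (g m x)) < e / 4"
  proof (rule L2_dominated_approximation[of X "\<lambda>x. clamp B (v x)" "\<lambda>m x. clamp B (g m x)" "\<lambda>_. B" "e / 4"])
    show "(\<lambda>x. clamp B (g m x)) \<in> borel_measurable ?M" for m
      unfolding clamp_def using continuous_on_subset[OF g(2)]
      by (intro continuous_measurable_lebesgue_on continuous_intros) auto
    have "AE x in lebesgue. x \<notin> N"
      using g(1) by (intro AE_not_in) (simp add: negligible_iff_null_sets)
    then have "AE x in ?M. x \<notin> N"
      by (subst AE_restrict_space_iff) (auto elim: AE_mp)
    moreover have "AE x in ?M. x \<in> {0..X}"
      by (intro AE_I2) (simp add: space_restrict_space)
    ultimately show "AE x in ?M. (\<lambda>m. clamp B (g m x)) \<longlonglongrightarrow> clamp B (v x)"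
    proof eventually_elim
      case (elim x)
      then have "(\<lambda>n. g n x) \<longlonglongrightarrow> v x" using g(3)[of x] by simp
      then show ?case unfolding clamp_def by (intro tendsto_intros)
    qed
  qed (use n clamp \<open>0 \<le> B\<close> const assms(3) in \<open>auto simp: B_def[symmetric]\<close>)
  define f where "f = (\<lambda>x. clamp B (g m x))"
  have contf: "continuous_on S f" for S
    unfolding f_def clamp_def using continuous_on_subset[OF g(2)]
    by (intro continuous_intros) auto
  \<comment> \<open>The factor vanishes at 0 and \<open>X\<close>, so that \<open>s k\<close>
    satisfies the matching condition of \<open>uniform_smooth_approximation\<close>; at each
    interior point it is eventually equal to 1.\<close>
  define s where "s = (\<lambda>k x. min 1 (real k * (x * (X - x))) * f x)"
  obtain k where k: "square_integrable X (s k)" "L2norm X (\<lambda>x. f x - s k x) < e / 4"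
  proof (rule L2_dominated_approximation[of X f s "\<lambda>_. B" "e / 4"])
    show "s k \<in> borel_measurable ?M" for k
      unfolding s_def by (intro continuous_measurable_lebesgue_on continuous_intros contf)
    show "\<bar>s k x\<bar> \<le> \<bar>B\<bar>" if "x \<in> {0..X}" for k x
    proof -
      have "0 \<le> min 1 (real k * (x * (X - x)))" using that by simp
      then have "\<bar>s k x\<bar> \<le> 1 * \<bar>f x\<bar>"
        unfolding s_def abs_mult by (intro mult_right_mono) auto
      then show ?thesis using clamp(1)[OF \<open>0 \<le> B\<close>, of "g m x"] by (simp add: f_def)
    qed
    have "AE x in lebesgue. x \<notin> {0, X}"
      by (intro AE_not_in) (simp add: negligible_iff_null_sets[symmetric])
    then have "AE x in ?M. x \<notin> {0, X}"
      by (subst AE_restrict_space_iff) (auto elim: AE_mp)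
    moreover have "AE x in ?M. x \<in> {0..X}"
      by (intro AE_I2) (simp add: space_restrict_space)
    ultimately show "AE x in ?M. (\<lambda>k. s k x) \<longlonglongrightarrow> f x"
    proof eventually_elim
      case (elim x)
      then have pos: "0 < x * (X - x)" by auto
      obtain N where N: "1 / (x * (X - x)) \<le> real N" using real_arch_simple by blast
      show ?case
      proof (rule tendsto_eventually)
        show "\<forall>\<^sub>F k in sequentially. s k x = f x"
          using eventually_ge_at_top[of N]
        proof eventually_elim
          case (elim k)
          then have "1 / (x * (X - x)) \<le> real k" using N by linarith
          then have "1 \<le> real k * (x * (X - x))" using pos by (simp only: pos_divide_le_eq)
          then show ?case by (simp add: s_def)
        qed
      qed
    qed
  qed (use m const assms(3) in \<open>auto simp: f_def\<close>)
  \<comment> \<open>Passing from the uniform norm to the \<open>L2\<close> norm costs a factor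
    \<open>sqrt X\<close>; the denominator absorbs it and stays positive through the added
    1.\<close>
  obtain p where p: "smooth p" "periodic_fun_simple p X"
      "\<And>x. x \<in> {0..X} \<Longrightarrow> \<bar>s k x - p x\<bar> < e / (4 * (sqrt X + 1))"
  proof (rule uniform_smooth_approximation[of X "s k" "e / (4 * (sqrt X + 1))"])
    show "continuous_on {0..X} (s k)"
      unfolding s_def by (intro continuous_intros contf)
  qed (use assms in \<open>auto simp: s_def intro!: divide_pos_pos mult_pos_pos add_nonneg_pos\<close>)
  have sp: "square_integrable X p" using p(1) by (rule square_integrable_smooth)
  have "L2norm X (\<lambda>x. s k x - p x) \<le> e / (4 * (sqrt X + 1)) * sqrt X"
    using assms(1) k(1) sp p(3) by (intro L2norm_bound square_integrable_diff) (auto intro: less_imp_le)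
  also have "\<dots> = e / 4 * (sqrt X / (sqrt X + 1))" by simp
  also have "\<dots> \<le> e / 4 * 1"
  proof (rule mult_left_mono)
    have "0 < sqrt X + 1" using assms(1) by (simp add: add_nonneg_pos)
    then show "sqrt X / (sqrt X + 1) \<le> 1" by (simp add: divide_le_eq)
  qed (use assms in simp)
  finally have 4: "L2norm X (\<lambda>x. s k x - p x) \<le> e / 4" by simp
  have sf: "square_integrable X f" using m(1) by (simp add: f_def)
  have "L2norm X (\<lambda>x. v x - p x) \<le> L2norm X (\<lambda>x. v x - clamp B (v x)) +
      (L2norm X (\<lambda>x. clamp B (v x) - f x) + (L2norm X (\<lambda>x. f x - s k x) + L2norm X (\<lambda>x. s k x - p x)))"
    using L2norm_triangle_diff[OF assms(2) n(1) sp] L2norm_triangle_diff[OF n(1) sf sp]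
      L2norm_triangle_diff[OF sf k(1) sp]
    unfolding B_def by linarith
  also have "\<dots> < e" using n(2) m(2) k(2) 4 unfolding f_def B_def by linarith
  finally show ?thesis using that p by blast
qed

subsection \<open>Weak derivatives\<close>

lemma is_weak_deriv_inprod:
  "is_weak_deriv X u v \<longleftrightarrow>
     (\<forall>\<phi>. smooth \<phi> \<and> periodic_fun_simple \<phi> X \<longrightarrow> inprod X u (deriv \<phi>) = - inprod X v \<phi>)"
  by (simp add: is_weak_deriv_def set_lebesgue_integral_lebesgue_on inprod_def)

lemma L2_square_integrable: "u \<in> L2 X \<Longrightarrow> square_integrable X u"
  unfolding L2_def square_integrable_def set_integrable_lebesgue_on
  by (auto intro: measurable_restrict_space1)

lemma L2_continuous:
  assumes "continuous_on UNIV u" "periodic_fun_simple u X"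
  shows "u \<in> L2 X"
proof -
  have "integrable (lebesgue_on {0..X}) (\<lambda>x. (u x)\<^sup>2)"
    using continuous_on_subset[OF assms(1)]
    by (intro continuous_integrable_lebesgue_on continuous_intros) auto
  moreover have "u \<in> borel_measurable lebesgue"
    using borel_measurable_continuous_onI[OF assms(1)] by (intro measurable_completion) simp
  ultimately show ?thesis
    using assms(2) by (simp add: L2_def set_integrable_lebesgue_on)
qed

lemma L2norm_le_0_imp_AE:
  assumes "square_integrable X u" "L2norm X u \<le> 0"
  shows "AE x in lebesgue_on {0..X}. u x = 0"
proof -
  have "L2norm X u = 0" using assms(2) L2norm_ge0[of X u] by simp
  then have "integral\<^sup>L (lebesgue_on {0..X}) (\<lambda>x. (u x)\<^sup>2) = 0"
    using L2norm_power2[of X u] by (simp add: inprod_def power2_eq_square)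
  then have "AE x in lebesgue_on {0..X}. (u x)\<^sup>2 = 0"
    using assms(1) by (subst (asm) integral_nonneg_eq_0_iff_AE) (auto simp: square_integrable_def)
  then show ?thesis by simp
qed

text \<open>The difference of two weak derivatives is orthogonal to every smooth periodic function.
  Such functions approximate the difference itself, so it is orthogonal to itself.\<close>

lemma weak_deriv_unique:
  assumes "0 < X" "square_integrable X v" "square_integrable X w"
    and "is_weak_deriv X u v" "is_weak_deriv X u w"
  shows "AE x in lebesgue_on {0..X}. v x = w x"
proof -
  let ?d = "\<lambda>x. v x - w x"
  have d: "square_integrable X ?d" using assms by (intro square_integrable_diff)
  have le: "(L2norm X ?d)\<^sup>2 \<le> L2norm X ?d * \<eta>" if \<eta>: "0 < \<eta>" for \<eta>
  proof -
    obtain p where p: "smooth p" "periodic_fun_simple p X" "L2norm X (\<lambda>x. ?d x - p x) < \<eta>"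
      using L2_smooth_dense[OF assms(1) d \<eta>] .
    have sp: "square_integrable X p" using p(1) by (rule square_integrable_smooth)
    have "inprod X ?d p = 0"
      using assms(4,5) p(1,2) unfolding inprod_diff[OF assms(2,3) sp]
      by (simp add: is_weak_deriv_inprod)
    moreover have "inprod X ?d (\<lambda>x. ?d x - p x) = inprod X ?d ?d - inprod X ?d p"
      using inprod_diff[OF d sp d] by (simp add: inprod_commute)
    ultimately have "(L2norm X ?d)\<^sup>2 = inprod X ?d (\<lambda>x. ?d x - p x)"
      by (simp add: L2norm_power2)
    also have "\<dots> \<le> L2norm X ?d * L2norm X (\<lambda>x. ?d x - p x)"
      using inprod_Cauchy_Schwarz[OF d square_integrable_diff[OF d sp]] by simp
    also have "\<dots> \<le> L2norm X ?d * \<eta>" using p(3) by (intro mult_left_mono) (auto simp: L2norm_ge0)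
    finally show ?thesis .
  qed
  have "L2norm X ?d \<le> 0"
  proof (rule ccontr)
    assume "\<not> L2norm X ?d \<le> 0"
    then show False using le[of "L2norm X ?d / 2"] by (simp add: power2_eq_square)
  qed
  from L2norm_le_0_imp_AE[OF d this] show ?thesis by simp
qed

text \<open>Integration by parts survives finitely many corners as long as \<open>u\<close> is
  continuous, and \<open>v\<close> may be anything there. Only the values on \<open>[0, X]\<close>
  are seen by the integrals, so periodicity of \<open>u\<close> enters through
  \<open>u 0 = u X\<close>. The corners are those of the cut-off functions in
  \<open>negative_direction_nodal\<close>.\<close>

lemma is_weak_deriv_piecewise:
  assumes "0 \<le> X" "continuous_on {0..X} u" "u 0 = u X" "finite S"
    and "\<And>x. x \<in> {0<..<X} - S \<Longrightarrow> (u has_real_derivative v x) (at x)"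
    and "square_integrable X v"
  shows "is_weak_deriv X u v"
  unfolding is_weak_deriv_inprod
proof (intro allI impI, elim conjE)
  fix \<phi> assume \<phi>: "smooth \<phi>" "periodic_fun_simple \<phi> X"
  have "((\<lambda>x. v x * \<phi> x + u x * deriv \<phi> x) has_integral u X * \<phi> X - u 0 * \<phi> 0) {0..X}"
  proof (rule fundamental_theorem_of_calculus_interior_strong[OF assms(4,1)])
    show "continuous_on {0..X} (\<lambda>x. u x * \<phi> x)"
      by (intro continuous_intros assms(2) smooth_continuous \<phi>)
    fix x assume "x \<in> {0<..<X} - S"
    then have "((\<lambda>x. u x * \<phi> x) has_real_derivative v x * \<phi> x + u x * deriv \<phi> x) (at x)"
      using assms(5)[of x] smooth_has_deriv[OF \<phi>(1), of x]
      by (auto intro!: derivative_eq_intros)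
    then show "((\<lambda>x. u x * \<phi> x) has_vector_derivative v x * \<phi> x + u x * deriv \<phi> x) (at x)"
      by (simp add: has_real_derivative_iff_has_vector_derivative)
  qed
  moreover have "u X * \<phi> X - u 0 * \<phi> 0 = 0"
    using assms(3) periodic_funD[OF \<phi>(2), of 0] by simp
  ultimately have "integral {0..X} (\<lambda>x. v x * \<phi> x + u x * deriv \<phi> x) = 0"
    by (simp add: integral_unique)
  moreover have i: "integrable (lebesgue_on {0..X}) (\<lambda>x. v x * \<phi> x)"
      "integrable (lebesgue_on {0..X}) (\<lambda>x. u x * deriv \<phi> x)"
    using assms(2,6) \<phi>
    by (auto intro: square_integrable_mult square_integrable_smooth smooth_deriv
        square_integrable_continuous)
  ultimately have "integral\<^sup>L (lebesgue_on {0..X}) (\<lambda>x. v x * \<phi> x + u x * deriv \<phi> x) = 0"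
    by (subst lebesgue_integral_eq_integral) auto
  then show "inprod X u (deriv \<phi>) = - inprod X v \<phi>"
    using i by (simp add: inprod_def)
qed

text \<open>\<open>weak_deriv\<close> is an arbitrary choice, so a classical derivative can be
  compared with it only almost everywhere; that is enough under an integral, and makes the energy
  computable.\<close>

lemma C1_H1:
  assumes "0 < X" "\<And>x. (u has_real_derivative u' x) (at x)" "continuous_on UNIV u'"
    and "periodic_fun_simple u X"
  shows "u \<in> H1 X" "AE x in lebesgue_on {0..X}. weak_deriv X u x = u' x"
    and "square_integrable X (weak_deriv X u)"
proof -
  have cu: "continuous_on UNIV u"
    using assms(2) by (meson DERIV_isCont continuous_at_imp_continuous_on)
  have u': "u' \<in> L2 X"
    using assms by (intro L2_continuous periodic_deriv[OF assms(4,2)])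
  have w: "is_weak_deriv X u u'"
    using assms(1,2) continuous_on_subset[OF cu] periodic_funD[OF assms(4), of 0]
    by (intro is_weak_deriv_piecewise[where S = "{}"] L2_square_integrable[OF u']) auto
  show "u \<in> H1 X"
    unfolding H1_def using L2_continuous[OF cu assms(4)] u' w by blast
  have "weak_deriv X u \<in> L2 X \<and> is_weak_deriv X u (weak_deriv X u)"
    unfolding weak_deriv_def by (rule someI[of _ u']) (use u' w in blast)
  then show "AE x in lebesgue_on {0..X}. weak_deriv X u x = u' x"
      "square_integrable X (weak_deriv X u)"
    using assms(1) u' w by (auto intro: weak_deriv_unique L2_square_integrable)
qed

lemma H1_weak_deriv:
  assumes "u \<in> H1 X"
  shows "weak_deriv X u \<in> L2 X" "is_weak_deriv X u (weak_deriv X u)"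
proof -
  obtain v where "v \<in> L2 X \<and> is_weak_deriv X u v" using assms by (auto simp: H1_def)
  then have "weak_deriv X u \<in> L2 X \<and> is_weak_deriv X u (weak_deriv X u)"
    unfolding weak_deriv_def by (rule someI[where P = "\<lambda>v. v \<in> L2 X \<and> is_weak_deriv X u v"])
  then show "weak_deriv X u \<in> L2 X" "is_weak_deriv X u (weak_deriv X u)" by auto
qed

lemma inprod_continuous:
  assumes "continuous_on {0..X} u" "continuous_on {0..X} v"
  shows "inprod X u v = integral {0..X} (\<lambda>x. u x * v x)"
  unfolding inprod_def by (intro continuous_lebesgue_on_eq_integral continuous_intros assms)

text \<open>Subtracting the mean \<open>m\<close> is an orthogonal projection: it lowers the squared
  norm by \<open>m^2 * X\<close>.\<close>

lemma L2norm_center: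
  assumes "0 < X" "square_integrable X f"
  shows "L2norm X (\<lambda>x. f x - inprod X f (\<lambda>_. 1) / X) \<le> L2norm X f"
proof -
  define m where "m = inprod X f (\<lambda>_. 1) / X"
  have m: "inprod X f (\<lambda>_. 1) = m * X" using assms(1) by (simp add: m_def)
  have "inprod X (\<lambda>_. 1) (\<lambda>_. 1) = X" using assms(1) by (simp add: inprod_continuous)
  then have "inprod X (\<lambda>x. f x - m) (\<lambda>x. f x - m) = inprod X f f - m\<^sup>2 * X"
    using inprod_add_square[OF assms(2) square_integrable_smooth[OF smooth_const[of 1]], of "-m"]
    by (simp add: m power2_eq_square)
  then show ?thesis
    using assms(1) unfolding m_def[symmetric] L2norm_def by simp
qed

text \<open>Mean zero is what makes the primitive periodic. Normalised to vanish at 0, it is bounded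
  pointwise by the integral of the absolute value of \<open>w\<close>, hence by
  \<open>sqrt X\<close> times the norm of \<open>w\<close>; integrating the square gives a second
  factor \<open>sqrt X\<close>.\<close>

lemma smooth_periodic_primitive:
  assumes "0 < X" "smooth w" "periodic_fun_simple w X" "inprod X w (\<lambda>_. 1) = 0"
  obtains W where "smooth W" "periodic_fun_simple W X" "\<And>x. (W has_real_derivative w x) (at x)"
    "L2norm X W \<le> X * L2norm X w"
proof -
  obtain F where F: "\<And>x. (F has_real_derivative w x) (at x)"
    using continuous_antiderivative smooth_continuous[OF assms(2)] by blast
  define W where "W = (\<lambda>x. F x - F 0)"
  have W: "(W has_real_derivative w x) (at x)" for x
    unfolding W_def using F[of x] by (auto intro!: derivative_eq_intros)
  have "integral {0..X} w = 0"
    using assms(4) by (simp add: inprod_continuous smooth_continuous assms(2))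
  then have 0: "W X = 0"
    using integral_unique[OF FTC_has_integral[OF _ W, of 0 X]] assms(1) by (simp add: W_def)
  have "((\<lambda>y. W (y + X) - W y) has_real_derivative w (y + X) - w y) (at y)" for y
    by (intro DERIV_diff DERIV_shift[THEN iffD1] W)
  then have "((\<lambda>y. W (y + X) - W y) has_real_derivative 0) (at y)" for y
    using periodic_funD[OF assms(3)] by simp
  then have "W (y + X) - W y = W (0 + X) - W 0" for y
    by (intro DERIV_isconst_all) blast
  then have per: "periodic_fun_simple W X"
    using 0 by (intro periodic_funI) (simp add: W_def)
  have smW: "smooth W" using W assms(2) by (rule smooth_primitive)
  have sw: "square_integrable X w" using assms(2) by (rule square_integrable_smooth)
  have saw: "square_integrable X (\<lambda>x. \<bar>w x\<bar>)"
    by (intro square_integrable_continuous continuous_intros smooth_continuous assms)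
  have "\<bar>W x\<bar> \<le> L2norm X w * sqrt X" if x: "x \<in> {0..X}" for x
  proof -
    have cw: "continuous_on S w" for S using assms(2) by (rule smooth_continuous)
    have "W x = integral {0..x} w"
      using integral_unique[OF FTC_has_integral[OF _ W, of 0 x]] x by (simp add: W_def)
    also have "\<bar>\<dots>\<bar> \<le> integral {0..x} (\<lambda>x. \<bar>w x\<bar>)"
      unfolding real_norm_def[symmetric]
      by (intro integral_norm_bound_integral integrable_continuous_real continuous_intros cw) auto
    also have "\<dots> \<le> integral {0..X} (\<lambda>x. \<bar>w x\<bar>)"
      using x by (intro integral_subset_le integrable_continuous_real continuous_intros cw) auto
    also have "\<dots> = inprod X (\<lambda>x. \<bar>w x\<bar>) (\<lambda>_. 1)"
      by (subst inprod_continuous) (auto intro!: continuous_intros cw)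
    also have "\<dots> \<le> L2norm X (\<lambda>x. \<bar>w x\<bar>) * L2norm X (\<lambda>_. 1)"
      using inprod_Cauchy_Schwarz[OF saw square_integrable_smooth[OF smooth_const[of 1]]] by simp
    also have "L2norm X (\<lambda>x. \<bar>w x\<bar>) = L2norm X w"
      by (simp add: L2norm_def inprod_def)
    also have "L2norm X w * L2norm X (\<lambda>_. 1) \<le> L2norm X w * (1 * sqrt X)"
      using assms(1) by (intro mult_left_mono L2norm_bound square_integrable_smooth smooth_const)
        (auto simp: L2norm_ge0)
    finally show ?thesis by simp
  qed
  then have "L2norm X W \<le> (L2norm X w * sqrt X) * sqrt X"
    using assms(1) smW by (intro L2norm_bound square_integrable_smooth) auto
  also have "\<dots> = X * L2norm X w" using assms(1) by simp
  finally show ?thesis using that smW per W by blast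
qed

text \<open>Since \<open>e\<close> is only known through its weak derivative, the estimate is
  obtained by duality. Choose a smooth \<open>p\<close> near \<open>e\<close>, subtract its mean and
  take a periodic primitive \<open>P\<close>; then the product of \<open>e\<close> and
  \<open>p\<close> equals minus that of \<open>d\<close> and \<open>P\<close>, and \<open>P\<close>
  is controlled by \<open>smooth_periodic_primitive\<close>. As the distance from \<open>p\<close>
  to \<open>e\<close> tends to 0, this becomes \<open>N^2 \<le> X * D * N\<close> for the norms
  \<open>N\<close> of \<open>e\<close> and \<open>D\<close> of \<open>d\<close>.\<close>

lemma weak_Poincare:
  assumes "0 < X" "square_integrable X e" "square_integrable X d" "is_weak_deriv X e d"
    and "inprod X e (\<lambda>_. 1) = 0"
  shows "L2norm X e \<le> X * L2norm X d"
proof -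
  let ?N = "L2norm X e" and ?D = "L2norm X d"
  have one: "square_integrable X (\<lambda>_. c)" for c by (rule square_integrable_smooth[OF smooth_const])
  have est: "?N\<^sup>2 - X * ?D * ?N \<le> \<eta> * (?N + X * ?D)" if \<eta>: "0 < \<eta>" for \<eta>
  proof -
    obtain p where p: "smooth p" "periodic_fun_simple p X" "L2norm X (\<lambda>x. e x - p x) < \<eta>"
      using L2_smooth_dense[OF assms(1,2) \<eta>] .
    have sp: "square_integrable X p" using p(1) by (rule square_integrable_smooth)
    define m where "m = inprod X p (\<lambda>_. 1) / X"
    let ?p0 = "\<lambda>x. p x - m"
    have p0: "smooth ?p0" "periodic_fun_simple ?p0 X"
      using p periodic_funD[OF p(2)] by (auto intro: smooth_diff smooth_const periodic_funI)
    have "inprod X ?p0 (\<lambda>_. 1) = inprod X p (\<lambda>_. 1) - inprod X (\<lambda>_. m) (\<lambda>_. 1)"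
      by (rule inprod_diff[OF sp one one])
    then have "inprod X ?p0 (\<lambda>_. 1) = 0"
      using assms(1) by (simp add: m_def inprod_continuous)
    then obtain P where P: "smooth P" "periodic_fun_simple P X"
        "\<And>x. (P has_real_derivative ?p0 x) (at x)" "L2norm X P \<le> X * L2norm X ?p0"
      using smooth_periodic_primitive[OF assms(1) p0] by blast
    have "deriv P = ?p0" using P(3) by (auto intro: DERIV_imp_deriv)
    then have "inprod X e ?p0 = - inprod X d P"
      using assms(4) P(1,2) unfolding is_weak_deriv_inprod by metis
    moreover have "inprod X e ?p0 = inprod X e p"
    proof -
      have "inprod X (\<lambda>_. m) e = 0"
        using assms(5) inprod_cmult[of X m "\<lambda>_. 1" e] by (simp add: inprod_commute)
      then show ?thesis
        using inprod_diff[OF sp one assms(2)] by (simp add: inprod_commute)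
    qed
    ultimately have "inprod X e p \<le> ?D * L2norm X P"
      using inprod_Cauchy_Schwarz[OF assms(3) square_integrable_smooth[OF P(1)]] by simp
    also have "\<dots> \<le> ?D * (X * L2norm X p)"
      using P(4) L2norm_center[OF assms(1) sp] assms(1)
      by (intro mult_left_mono[OF _ L2norm_ge0] order_trans[OF P(4)]) (auto simp: m_def)
    also have "\<dots> \<le> ?D * (X * (?N + \<eta>))"
    proof -
      have "L2norm X p \<le> L2norm X e + L2norm X (\<lambda>x. p x - e x)"
        using L2norm_triangle[OF assms(2) square_integrable_diff[OF sp assms(2)]] by simp
      then have "L2norm X p \<le> ?N + \<eta>" using p(3) by (simp add: L2norm_minus_commute[of X p])
      then show ?thesis using assms(1) by (intro mult_left_mono[OF _ L2norm_ge0] mult_left_mono) auto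
    qed
    finally have "inprod X e p \<le> ?D * (X * (?N + \<eta>))" .
    moreover have "?N\<^sup>2 - inprod X e p \<le> ?N * \<eta>"
    proof -
      have "?N\<^sup>2 - inprod X e p = inprod X e (\<lambda>x. e x - p x)"
        using inprod_diff[OF assms(2) sp assms(2)] by (simp add: L2norm_power2 inprod_commute)
      also have "\<dots> \<le> ?N * L2norm X (\<lambda>x. e x - p x)"
        using inprod_Cauchy_Schwarz[OF assms(2) square_integrable_diff[OF assms(2) sp]] by simp
      also have "\<dots> \<le> ?N * \<eta>" using p(3) by (intro mult_left_mono L2norm_ge0) auto
      finally show ?thesis .
    qed
    ultimately show ?thesis by (simp add: algebra_simps)
  qed
  have "((\<lambda>\<eta>. \<eta> * (?N + X * ?D)) \<longlongrightarrow> 0 * (?N + X * ?D)) (at_right 0)"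
    by (intro tendsto_intros)
  then have "?N\<^sup>2 - X * ?D * ?N \<le> 0 * (?N + X * ?D)"
    by (rule tendsto_lowerbound) (use est in \<open>auto simp: eventually_at_right_less intro: eventually_at_rightI[of 0 1]\<close>)
  then have "?N * ?N \<le> (X * ?D) * ?N" by (simp add: power2_eq_square)
  then show ?thesis
    using L2norm_ge0[of X e] L2norm_ge0[of X d] assms(1)
    by (cases "?N = 0") (auto simp: mult_le_cancel_right)
qed

section \<open>From weak to smooth negative directions\<close>

lemma L2norm_mult_bound:
  assumes "continuous_on {0..X} q" "square_integrable X u" "\<And>x. x \<in> {0..X} \<Longrightarrow> \<bar>q x\<bar> \<le> B" "0 \<le> B"
  shows "L2norm X (\<lambda>x. q x * u x) \<le> B * L2norm X u"
proof -
  have "integral\<^sup>L (lebesgue_on {0..X}) (\<lambda>x. (q x * u x)\<^sup>2)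
      \<le> integral\<^sup>L (lebesgue_on {0..X}) (\<lambda>x. B\<^sup>2 * (u x)\<^sup>2)"
  proof (rule integral_mono)
    show "integrable (lebesgue_on {0..X}) (\<lambda>x. (q x * u x)\<^sup>2)"
      using square_integrable_continuous_mult[OF assms(1,2)] by (simp add: square_integrable_def)
    show "integrable (lebesgue_on {0..X}) (\<lambda>x. B\<^sup>2 * (u x)\<^sup>2)"
      using assms(2) by (simp add: square_integrable_def)
    show "(q x * u x)\<^sup>2 \<le> B\<^sup>2 * (u x)\<^sup>2" if "x \<in> space (lebesgue_on {0..X})" for x
      unfolding power_mult_distrib
      using power_mono[OF assms(3)[of x], of 2] that
      by (intro mult_right_mono) (auto simp: space_restrict_space)
  qed
  then have "(L2norm X (\<lambda>x. q x * u x))\<^sup>2 \<le> (B * L2norm X u)\<^sup>2"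
    unfolding power_mult_distrib L2norm_power2 inprod_def by (simp add: power2_eq_square mult_ac)
  then show ?thesis by (rule power2_le_imp_le) (use assms(4) L2norm_ge0 in auto)
qed

text \<open>All three sufficient conditions for energy instability at period \<open>X\<close> are
  reduced to such a function, with \<open>q\<close> the composition of \<open>r\<close> and
  \<open>h\<close>. Smoothness is built in because \<open>energy_unstable\<close> asks for
  it.\<close>

definition negative_direction :: "real \<Rightarrow> (real \<Rightarrow> real) \<Rightarrow> (real \<Rightarrow> real) \<Rightarrow> bool" where
  "negative_direction X q \<phi> \<longleftrightarrow> smooth \<phi> \<and> periodic_fun_simple \<phi> X \<and> integral {0..X} \<phi> = 0 \<and>
     integral {0..X} (\<lambda>x. (deriv \<phi> x)\<^sup>2 - q x * (\<phi> x)\<^sup>2) < 0"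

lemma smooth_negative_direction:
  assumes "0 < X" "continuous_on {0..X} q" "square_integrable X u" "square_integrable X v"
    and "is_weak_deriv X u v" "inprod X u (\<lambda>_. 1) = 0"
    and "inprod X v v - inprod X (\<lambda>x. q x * u x) u < 0"
  shows "\<exists>\<phi>. negative_direction X q \<phi>"
proof -
  have one: "square_integrable X (\<lambda>_. c)" for c by (rule square_integrable_smooth[OF smooth_const])
  have "bounded (q ` {0..X})"
    using assms(2) by (intro compact_imp_bounded compact_continuous_image) auto
  then obtain B where B: "0 < B" "\<And>x. x \<in> {0..X} \<Longrightarrow> \<bar>q x\<bar> \<le> B"
    unfolding bounded_pos by auto
  let ?Nu = "L2norm X u" and ?Nv = "L2norm X v" and ?q = "inprod X (\<lambda>x. q x * u x) u"
  \<comment> \<open>\<open>?F \<delta>\<close> will bound the form at the smooth substitute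
    \<open>\<phi>\<close> of \<open>u\<close>. Its derivative has norm at most
    \<open>?Nv + \<delta>\<close>, and the \<open>q\<close>-term changes by at most \<open>B\<close>
    times the norms of \<open>u - \<phi>\<close> and \<open>u + \<phi>\<close>, which are at most
    \<open>X * \<delta>\<close> and \<open>2 * ?Nu + X * \<delta>\<close>.\<close>
  let ?F = "\<lambda>\<delta>. (?Nv + \<delta>)\<^sup>2 - ?q + B * (X * \<delta>) * (2 * ?Nu + X * \<delta>)"
  have "(?F \<longlongrightarrow> ?F 0) (at_right 0)"
    by (intro tendsto_intros)
  moreover have "?F 0 < 0" using assms(7) by (simp add: L2norm_power2)
  ultimately have "\<forall>\<^sub>F \<delta> in at_right 0. ?F \<delta> < 0" by (rule order_tendstoD)
  then have "\<forall>\<^sub>F \<delta> in at_right 0. ?F \<delta> < 0 \<and> 0 < \<delta>"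
    using eventually_at_right_less[of "0::real"] by (rule eventually_conj)
  then obtain \<delta> where \<delta>: "?F \<delta> < 0" "0 < \<delta>"
    using eventually_happens'[of "at_right (0::real)"] by auto
  \<comment> \<open>Testing against the constant 1 shows that \<open>v\<close> has mean zero. Hence
    the mean of \<open>v - w0\<close> is minus that of \<open>w0\<close>, and centring
    \<open>w0\<close> does not increase its distance to \<open>v\<close>.\<close>
  have "inprod X u (deriv (\<lambda>_. 1)) = - inprod X v (\<lambda>_. 1)"
    using assms(5) smooth_const[of 1] unfolding is_weak_deriv_inprod
    by (auto intro: periodic_funI)
  moreover have "inprod X u (deriv (\<lambda>_. 1)) = 0" by (simp add: inprod_def)
  ultimately have mv: "inprod X v (\<lambda>_. 1) = 0" by simp
  obtain w0 where w0: "smooth w0" "periodic_fun_simple w0 X" "L2norm X (\<lambda>x. v x - w0 x) < \<delta>"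
    using L2_smooth_dense[OF assms(1,4) \<delta>(2)] .
  have sw0: "square_integrable X w0" using w0(1) by (rule square_integrable_smooth)
  define m where "m = inprod X w0 (\<lambda>_. 1) / X"
  define w where "w = (\<lambda>x. w0 x - m)"
  have w: "smooth w" "periodic_fun_simple w X"
    unfolding w_def using w0 periodic_funD[OF w0(2)]
    by (auto intro: smooth_diff smooth_const periodic_funI)
  have sw: "square_integrable X w" using w(1) by (rule square_integrable_smooth)
  have "inprod X (\<lambda>x. v x - w0 x) (\<lambda>_. 1) = - (m * X)"
    using assms(1) by (simp add: inprod_diff[OF assms(4) sw0 one] mv m_def)
  then have "L2norm X (\<lambda>x. v x - w x) \<le> L2norm X (\<lambda>x. v x - w0 x)"
    using L2norm_center[OF assms(1) square_integrable_diff[OF assms(4) sw0]] assms(1)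
    by (simp add: w_def algebra_simps)
  with w0(3) have nd: "L2norm X (\<lambda>x. v x - w x) < \<delta>" by simp
  have "inprod X w (\<lambda>_. 1) = inprod X w0 (\<lambda>_. 1) - inprod X (\<lambda>_. m) (\<lambda>_. 1)"
    unfolding w_def by (rule inprod_diff[OF sw0 one one])
  then have "inprod X w (\<lambda>_. 1) = 0"
    using assms(1) by (simp add: m_def inprod_continuous)
  then obtain W where W: "smooth W" "periodic_fun_simple W X"
      "\<And>x. (W has_real_derivative w x) (at x)"
    using smooth_periodic_primitive[OF assms(1) w] by blast
  define c where "c = inprod X W (\<lambda>_. 1) / X"
  define \<phi> where "\<phi> = (\<lambda>x. W x - c)"
  have \<phi>: "smooth \<phi>" "periodic_fun_simple \<phi> X"
    unfolding \<phi>_def using W periodic_funD[OF W(2)]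
    by (auto intro: smooth_diff smooth_const periodic_funI)
  have s\<phi>: "square_integrable X \<phi>" using \<phi>(1) by (rule square_integrable_smooth)
  have d\<phi>: "(\<phi> has_real_derivative w x) (at x)" for x
    unfolding \<phi>_def using W(3)[of x] by (auto intro!: derivative_eq_intros)
  have "inprod X \<phi> (\<lambda>_. 1) = inprod X W (\<lambda>_. 1) - inprod X (\<lambda>_. c) (\<lambda>_. 1)"
    unfolding \<phi>_def by (rule inprod_diff[OF square_integrable_smooth[OF W(1)] one one])
  then have m\<phi>: "inprod X \<phi> (\<lambda>_. 1) = 0"
    using assms(1) by (simp add: c_def inprod_continuous)
  define e where "e = (\<lambda>x. u x - \<phi> x)"
  have se: "square_integrable X e" unfolding e_def using assms(3) s\<phi> by (rule square_integrable_diff)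
  have "is_weak_deriv X \<phi> w"
    using assms(1) periodic_funD[OF \<phi>(2), of 0] d\<phi> sw smooth_continuous[OF \<phi>(1)]
    by (intro is_weak_deriv_piecewise[where S = "{}"]) auto
  then have "is_weak_deriv X e (\<lambda>x. v x - w x)"
    using assms(5) unfolding is_weak_deriv_inprod e_def
    by (simp add: inprod_diff[OF assms(3) s\<phi>] inprod_diff[OF assms(4) sw]
        square_integrable_smooth smooth_deriv)
  then have "L2norm X e \<le> X * L2norm X (\<lambda>x. v x - w x)"
    using assms m\<phi> by (intro weak_Poincare[OF assms(1) se square_integrable_diff[OF assms(4) sw]])
      (simp_all add: e_def inprod_diff[OF assms(3) s\<phi> one])
  also have "\<dots> \<le> X * \<delta>" using nd assms(1) by simp
  finally have ne: "L2norm X e \<le> X * \<delta>" .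
  have "L2norm X w \<le> ?Nv + L2norm X (\<lambda>x. w x - v x)"
    using L2norm_triangle[OF assms(4) square_integrable_diff[OF sw assms(4)]] by simp
  then have "L2norm X w \<le> ?Nv + \<delta>" using nd by (simp add: L2norm_minus_commute[of X w])
  then have 1: "inprod X w w \<le> (?Nv + \<delta>)\<^sup>2"
    unfolding L2norm_power2[symmetric] by (intro power_mono L2norm_ge0)
  have sq: "square_integrable X (\<lambda>x. q x * y x)" if "square_integrable X y" for y
    using square_integrable_continuous_mult[OF assms(2) that] .
  have su\<phi>: "square_integrable X (\<lambda>x. u x + \<phi> x)" using assms(3) s\<phi> by (rule square_integrable_add)
  \<comment> \<open>This is the factorisation of \<open>u^2 - \<phi>^2\<close> under the weight
    \<open>q\<close>.\<close>
  have "?q - inprod X (\<lambda>x. q x * \<phi> x) \<phi> = inprod X (\<lambda>x. q x * e x) (\<lambda>x. u x + \<phi> x)"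
    unfolding inprod_def
    using square_integrable_mult[OF sq[OF assms(3)] assms(3)] square_integrable_mult[OF sq[OF s\<phi>] s\<phi>]
    by (subst Bochner_Integration.integral_diff[symmetric])
       (auto simp: e_def algebra_simps intro!: Bochner_Integration.integral_cong)
  also have "\<dots> \<le> L2norm X (\<lambda>x. q x * e x) * L2norm X (\<lambda>x. u x + \<phi> x)"
    using inprod_Cauchy_Schwarz[OF sq[OF se] su\<phi>] by simp
  also have "\<dots> \<le> (B * (X * \<delta>)) * (2 * ?Nu + X * \<delta>)"
  proof (rule mult_mono)
    show "L2norm X (\<lambda>x. q x * e x) \<le> B * (X * \<delta>)"
      using L2norm_mult_bound[OF assms(2) se B(2)] B(1) mult_left_mono[OF ne, of B] by linarith
    \<comment> \<open>The sum \<open>u + \<phi>\<close> is written as \<open>2 * u - e\<close>,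
      because bounds are available for \<open>u\<close> and \<open>e\<close>.\<close>
    have "L2norm X (\<lambda>x. 2 * u x + (-1) * e x) \<le> L2norm X (\<lambda>x. 2 * u x) + L2norm X (\<lambda>x. (-1) * e x)"
      using assms(3) se by (intro L2norm_triangle square_integrable_cmult)
    also have "\<dots> \<le> 2 * ?Nu + X * \<delta>" using ne unfolding L2norm_cmult by simp
    finally show "L2norm X (\<lambda>x. u x + \<phi> x) \<le> 2 * ?Nu + X * \<delta>" by (simp add: e_def)
  qed (use B assms(1) \<delta>(2) in \<open>auto simp: L2norm_ge0\<close>)
  finally have "inprod X w w - inprod X (\<lambda>x. q x * \<phi> x) \<phi> \<le> ?F \<delta>" using 1 by simp
  then have neg: "inprod X w w - inprod X (\<lambda>x. q x * \<phi> x) \<phi> < 0" using \<delta>(1) by simp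
  have cw: "continuous_on {0..X} w" "continuous_on {0..X} \<phi>"
    using w(1) \<phi>(1) by (auto intro: smooth_continuous)
  have dw: "deriv \<phi> = w" using d\<phi> by (auto intro: DERIV_imp_deriv)
  have "integral {0..X} (\<lambda>x. (deriv \<phi> x)\<^sup>2 - q x * (\<phi> x)\<^sup>2) =
      integral {0..X} (\<lambda>x. w x * w x) - integral {0..X} (\<lambda>x. q x * \<phi> x * \<phi> x)"
    unfolding dw by (subst integral_diff[symmetric])
       (auto simp: power2_eq_square mult.assoc
         intro!: integrable_continuous_real continuous_intros cw assms(2))
  also have "\<dots> = inprod X w w - inprod X (\<lambda>x. q x * \<phi> x) \<phi>"
    using cw assms(2) by (simp add: inprod_continuous continuous_intros)
  finally show ?thesis
    using \<phi> neg m\<phi> cw by (auto simp: inprod_continuous negative_direction_def)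
qed

text \<open>Along \<open>u + t * w\<close> the form is the quadratic polynomial
  \<open>A + 2 * t * B + t^2 * C\<close> with \<open>A\<close> at most zero and \<open>B\<close>
  nonzero, so it is negative for small \<open>t\<close> of the sign opposite to \<open>B\<close>.
  The hypothesis \<open>ne\<close> says exactly that \<open>B\<close> is nonzero.\<close>

lemma negative_direction_of_noncritical:
  assumes X: "0 < X" and q: "continuous_on {0..X} q"
    and u: "square_integrable X u" "square_integrable X v" "is_weak_deriv X u v"
      "inprod X u (\<lambda>_. 1) = 0" "inprod X v v - inprod X (\<lambda>x. q x * u x) u \<le> 0"
    and w: "\<And>x. (w has_real_derivative w' x) (at x)" "continuous_on UNIV w'"
      "periodic_fun_simple w X" "integral {0..X} w = 0"
    and ne: "inprod X v w' - inprod X (\<lambda>x. q x * u x) w \<noteq> 0"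
  shows "\<exists>\<phi>. negative_direction X q \<phi>"
proof -
  have cw: "continuous_on S w" for S
    using w(1) by (meson DERIV_isCont continuous_at_imp_continuous_on)
  have cw': "continuous_on S w'" for S using w(2) continuous_on_subset by blast
  have sw: "square_integrable X w" "square_integrable X w'"
    by (intro square_integrable_continuous cw cw')+
  have sq: "square_integrable X (\<lambda>x. q x * y x)" if "square_integrable X y" for y
    by (rule square_integrable_continuous_mult[OF q that])
  have ww: "is_weak_deriv X w w'"
    using X w(1) cw periodic_funD[OF w(3), of 0] sw
    by (intro is_weak_deriv_piecewise[where S = "{}"]) auto
  define A where "A = inprod X v v - inprod X (\<lambda>x. q x * u x) u"
  define B where "B = inprod X v w' - inprod X (\<lambda>x. q x * u x) w"
  define C where "C = inprod X w' w' - inprod X (\<lambda>x. q x * w x) w"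
  \<comment> \<open>With this denominator \<open>t^2 * C\<close> is at most \<open>- t * B\<close>,
    so half of the linear term survives, whatever the sign of \<open>C\<close>.\<close>
  define t where "t = - B / (\<bar>C\<bar> + 1)"
  have "A + 2 * t * B + t\<^sup>2 * C < 0"
  proof -
    have pos: "0 < \<bar>C\<bar> + 1" by simp
    have "t\<^sup>2 * C \<le> t\<^sup>2 * (\<bar>C\<bar> + 1)" by (intro mult_left_mono) auto
    also have "\<dots> = B\<^sup>2 / (\<bar>C\<bar> + 1)"
      using pos by (simp add: t_def power_divide power2_eq_square)
    finally have "t\<^sup>2 * C \<le> B\<^sup>2 / (\<bar>C\<bar> + 1)" .
    moreover have "t * B = - (B\<^sup>2 / (\<bar>C\<bar> + 1))" by (simp add: t_def power2_eq_square)
    moreover have "0 < B\<^sup>2 / (\<bar>C\<bar> + 1)" using ne pos by (intro divide_pos_pos) (auto simp: B_def)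
    moreover have "A \<le> 0" using u(5) by (simp add: A_def)
    ultimately show ?thesis by linarith
  qed
  show ?thesis
  proof (rule smooth_negative_direction[OF X q])
    show su: "square_integrable X (\<lambda>x. u x + t * w x)"
      and "square_integrable X (\<lambda>x. v x + t * w' x)"
      by (intro square_integrable_add square_integrable_cmult u sw)+
    have tw: "square_integrable X (\<lambda>x. t * w x)" "square_integrable X (\<lambda>x. t * w' x)"
      by (intro square_integrable_cmult sw)+
    have one: "square_integrable X (\<lambda>_. 1)" by (rule square_integrable_smooth[OF smooth_const])
    show "is_weak_deriv X (\<lambda>x. u x + t * w x) (\<lambda>x. v x + t * w' x)"
      using u(3) ww unfolding is_weak_deriv_inprod
      by (simp add: inprod_add[OF u(1) tw(1)] inprod_add[OF u(2) tw(2)] inprod_cmult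
          square_integrable_smooth smooth_deriv)
    have "inprod X w (\<lambda>_. 1) = 0" using w(4) by (simp add: inprod_continuous cw)
    then show "inprod X (\<lambda>x. u x + t * w x) (\<lambda>_. 1) = 0"
      using u(4) by (simp add: inprod_add[OF u(1) tw(1) one] inprod_cmult)
    have "inprod X (\<lambda>x. q x * (u x + t * w x)) (\<lambda>x. u x + t * w x) =
        inprod X (\<lambda>x. q x * u x) u + 2 * t * inprod X (\<lambda>x. q x * u x) w +
        t\<^sup>2 * inprod X (\<lambda>x. q x * w x) w"
    proof -
      have "inprod X (\<lambda>x. q x * (u x + t * w x)) (\<lambda>x. u x + t * w x) =
        integral\<^sup>L (lebesgue_on {0..X}) (\<lambda>x. (q x * u x) * u x +
          2 * t * ((q x * u x) * w x) + t\<^sup>2 * ((q x * w x) * w x))"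
        unfolding inprod_def
        by (intro Bochner_Integration.integral_cong) (auto simp: algebra_simps power2_eq_square)
      then show ?thesis
        using square_integrable_mult[OF sq[OF u(1)] u(1)] square_integrable_mult[OF sq[OF u(1)] sw(1)]
          square_integrable_mult[OF sq[OF sw(1)] sw(1)]
        by (simp add: inprod_def)
    qed
    then show "inprod X (\<lambda>x. v x + t * w' x) (\<lambda>x. v x + t * w' x) -
        inprod X (\<lambda>x. q x * (u x + t * w x)) (\<lambda>x. u x + t * w x) < 0"
      using \<open>A + 2 * t * B + t\<^sup>2 * C < 0\<close> unfolding A_def B_def C_def
      by (simp add: inprod_add_square[OF u(2) sw(2)] algebra_simps)
  qed
qed

subsection \<open>Energy near a steady state\<close>

lemma integral_pos_continuous:
  fixes f :: "real \<Rightarrow> real"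
  assumes "a < b" "continuous_on {a..b} f" "\<And>x. x \<in> {a..b} \<Longrightarrow> 0 \<le> f x" "c \<in> {a..b}" "f c \<noteq> 0"
  shows "0 < integral {a..b} f"
proof (rule ccontr)
  assume "\<not> 0 < integral {a..b} f"
  moreover have i: "f integrable_on {a..b}" by (rule integrable_continuous_real[OF assms(2)])
  moreover have "0 \<le> integral {a..b} f" using i assms(3) by (rule integral_nonneg)
  ultimately have "(f has_integral 0) (cbox a b)" by (simp add: has_integral_integral)
  from has_integral_0_cbox_imp_0[OF _ _ this, of c] show False using assms by auto
qed

lemma periodic_bounded:
  fixes f :: "real \<Rightarrow> real"
  assumes "0 < X" "continuous_on UNIV f" "periodic_fun_simple f X"
  obtains B where "0 < B" "\<And>x. \<bar>f x\<bar> \<le> B"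
proof -
  have "bounded (f ` {0..X})"
    using continuous_on_subset[OF assms(2)]
    by (intro compact_imp_bounded compact_continuous_image) auto
  then obtain B where B: "0 < B" "\<And>x. x \<in> {0..X} \<Longrightarrow> \<bar>f x\<bar> \<le> B"
    unfolding bounded_pos by auto
  have "\<bar>f x\<bar> \<le> B" for x
  proof -
    obtain y where "0 \<le> y" "y \<le> X" "f x = f y"
      using periodic_reduce[OF assms(1)] assms(3) by metis
    then show ?thesis using B(2)[of y] by simp
  qed
  with B(1) show ?thesis by (rule that)
qed

lemma periodic_lower_bound:
  fixes f :: "real \<Rightarrow> real"
  assumes "0 < X" "continuous_on UNIV f" "periodic_fun_simple f X" "\<And>x. 0 < f x"
  obtains m where "0 < m" "\<And>x. m \<le> f x"
proof -
  have "\<exists>c\<in>{0..X}. \<forall>y\<in>{0..X}. f c \<le> f y"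
    by (rule continuous_attains_inf) (use continuous_on_subset[OF assms(2)] assms(1) in auto)
  then obtain c where c: "\<And>y. y \<in> {0..X} \<Longrightarrow> f c \<le> f y" by blast
  have "f c \<le> f x" for x
  proof -
    obtain y where "0 \<le> y" "y \<le> X" "f x = f y"
      using periodic_reduce[OF assms(1)] assms(3) by metis
    then show ?thesis using c[of y] by simp
  qed
  with assms(4) that show ?thesis by blast
qed

text \<open>The coefficients \<open>f\<close> and \<open>g\<close> have been eliminated:
  \<open>dh2\<close> is the equation integrated once and divided by \<open>f(h)\<close>, with zero
  constant. \<open>G\<close> stands for \<open>H'\<close>, and all derivatives are named so that
  computations use \<open>has_real_derivative\<close> facts instead of iterates of
  \<open>deriv\<close>.\<close>

locale steady_state =
  fixes X :: real and H G r r1 r2 h h1 h2 :: "real \<Rightarrow> real"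
  assumes X: "0 < X"
    and dH: "\<And>y. 0 < y \<Longrightarrow> (H has_real_derivative G y) (at y)"
    and dG: "\<And>y. 0 < y \<Longrightarrow> (G has_real_derivative r y) (at y)"
    and dr: "\<And>y. 0 < y \<Longrightarrow> (r has_real_derivative r1 y) (at y)"
    and dr1: "\<And>y. 0 < y \<Longrightarrow> (r1 has_real_derivative r2 y) (at y)"
    and cr2: "continuous_on {0<..} r2"
    and dh: "\<And>x. (h has_real_derivative h1 x) (at x)"
    and dh1: "\<And>x. (h1 has_real_derivative h2 x) (at x)"
    and dh2: "\<And>x. (h2 has_real_derivative - (r (h x) * h1 x)) (at x)"
    and per: "periodic_fun_simple h X"
    and hpos: "\<And>x. 0 < h x"
begin

lemma periodic: "periodic_fun_simple h1 X" "periodic_fun_simple h2 X"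
  using periodic_deriv[OF per dh] periodic_deriv[OF periodic_deriv[OF per dh] dh1] .

lemma shift [simp]: "h (x + X) = h x" "h1 (x + X) = h1 x" "h2 (x + X) = h2 x"
  using periodic_funD per periodic by blast+

lemma continuous_potentials:
  "continuous_on {0<..} H" "continuous_on {0<..} G" "continuous_on {0<..} r" "continuous_on {0<..} r1"
  using dH dG dr dr1 by (meson DERIV_isCont continuous_at_imp_continuous_on greaterThan_iff)+

lemma cont_h: "continuous_on S h" and cont_h1: "continuous_on S h1" and cont_h2: "continuous_on S h2"
  using dh dh1 dh2 by (meson DERIV_isCont continuous_at_imp_continuous_on)+

lemma cont_comp: "continuous_on {0<..} F \<Longrightarrow> continuous_on S (\<lambda>x. F (h x))"
  by (rule continuous_on_compose2[OF _ cont_h]) (use hpos in auto)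

lemmas cont = cont_h cont_h1 cont_h2 continuous_potentials[THEN cont_comp] cr2[THEN cont_comp]

lemma chain:
  "((\<lambda>x. G (h x)) has_real_derivative r (h x) * h1 x) (at x)"
  "((\<lambda>x. r (h x)) has_real_derivative r1 (h x) * h1 x) (at x)"
  "((\<lambda>x. r1 (h x)) has_real_derivative r2 (h x) * h1 x) (at x)"
  using dG[OF hpos] dr[OF hpos] dr1[OF hpos] dh by (auto intro: DERIV_chain2)

lemma first_integral: "h2 x + G (h x) = h2 0 + G (h 0)"
proof -
  have "((\<lambda>x. h2 x + G (h x)) has_real_derivative - (r (h x) * h1 x) + r (h x) * h1 x) (at x)" for x
    by (intro DERIV_add dh2 chain)
  then have "((\<lambda>x. h2 x + G (h x)) has_real_derivative 0) (at x)" for x by simp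
  then show ?thesis by (intro DERIV_isconst_all) blast
qed

definition Q :: "(real \<Rightarrow> real) \<Rightarrow> (real \<Rightarrow> real) \<Rightarrow> real" where
  "Q u u' = integral {0..X} (\<lambda>x. (u' x)\<^sup>2 - r (h x) * (u x)\<^sup>2)"

lemma energy_C1:
  assumes "\<And>x. (l has_real_derivative l' x) (at x)" "continuous_on UNIV l'"
    and "periodic_fun_simple l X" "\<And>x. 0 < l x"
  shows "energy H X l = integral {0..X} (\<lambda>x. (l' x)\<^sup>2 / 2 - H (l x))"
proof -
  have cl: "continuous_on S l" for S
    using assms(1) by (meson DERIV_isCont continuous_at_imp_continuous_on)
  have cl': "continuous_on S l'" for S
    using assms(2) continuous_on_subset by blast
  have cH: "continuous_on {0..X} (\<lambda>x. H (l x))"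
    by (rule continuous_on_compose2[OF continuous_potentials(1) cl]) (use assms(4) in auto)
  have c: "continuous_on {0..X} (\<lambda>x. (l' x)\<^sup>2 / 2 - H (l x))"
    by (intro continuous_intros cH cl') auto
  have "energy H X l = integral\<^sup>L (lebesgue_on {0..X}) (\<lambda>x. (weak_deriv X l x)\<^sup>2 / 2 - H (l x))"
    by (simp add: energy_def set_lebesgue_integral_lebesgue_on)
  also have "\<dots> = integral\<^sup>L (lebesgue_on {0..X}) (\<lambda>x. (l' x)\<^sup>2 / 2 - H (l x))"
  proof (rule integral_cong_AE)
    show "(\<lambda>x. (weak_deriv X l x)\<^sup>2 / 2 - H (l x)) \<in> borel_measurable (lebesgue_on {0..X})"
      using C1_H1(3)[OF X assms(1-3)] continuous_measurable_lebesgue_on[OF cH]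
      by (auto simp: square_integrable_def)
    show "(\<lambda>x. (l' x)\<^sup>2 / 2 - H (l x)) \<in> borel_measurable (lebesgue_on {0..X})"
      by (rule continuous_measurable_lebesgue_on[OF c])
    show "AE x in lebesgue_on {0..X}. (weak_deriv X l x)\<^sup>2 / 2 - H (l x) = (l' x)\<^sup>2 / 2 - H (l x)"
      using C1_H1(2)[OF X assms(1-3)] by eventually_elim simp
  qed
  also have "\<dots> = integral {0..X} (\<lambda>x. (l' x)\<^sup>2 / 2 - H (l x))"
    by (rule continuous_lebesgue_on_eq_integral[OF c])
  finally show ?thesis .
qed

lemma H1_mean_zeroI:
  assumes "\<And>x. (u has_real_derivative u' x) (at x)" "continuous_on UNIV u'"
    and "periodic_fun_simple u X" "integral {0..X} u = 0"
  shows "u \<in> H1_mean_zero X"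
proof -
  have "continuous_on {0..X} u"
    using assms(1) by (meson DERIV_isCont continuous_at_imp_continuous_on)
  then show ?thesis
    using C1_H1(1)[OF X assms(1-3)] assms(4)
    by (simp add: H1_mean_zero_def set_lebesgue_integral_lebesgue_on continuous_lebesgue_on_eq_integral)
qed

text \<open>Up to the total derivative of \<open>h1 * u\<close>, the integrand is \<open>u\<close>
  times the constant of \<open>first_integral\<close>, with a minus sign, and \<open>u\<close> has
  mean zero.\<close>

lemma first_variation:
  assumes "\<And>x. (u has_real_derivative u' x) (at x)" "continuous_on UNIV u'"
    and "periodic_fun_simple u X" "integral {0..X} u = 0"
  shows "((\<lambda>x. h1 x * u' x - G (h x) * u x) has_integral 0) {0..X}"
proof -
  have "((\<lambda>x. h1 x * u x) has_real_derivative h2 x * u x + h1 x * u' x) (at x)" for x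
    using dh1[of x] assms(1)[of x] by (auto intro!: derivative_eq_intros)
  from FTC_periodic[OF less_imp_le[OF X] this]
  have "((\<lambda>x. h2 x * u x + h1 x * u' x) has_integral 0) {0..X}"
    using periodic_funD[OF assms(3)] by (simp add: periodic_funI)
  moreover have "continuous_on {0..X} u"
    using assms(1) by (meson DERIV_isCont continuous_at_imp_continuous_on)
  then have "(u has_integral 0) {0..X}"
    using assms(4) by (metis integrable_continuous_real has_integral_integral)
  then have "((\<lambda>x. (h2 0 + G (h 0)) * u x) has_integral (h2 0 + G (h 0)) * 0) {0..X}"
    by (rule has_integral_mult_right)
  ultimately have "((\<lambda>x. (h2 x * u x + h1 x * u' x) - (h2 0 + G (h 0)) * u x) has_integral
      0 - (h2 0 + G (h 0)) * 0) {0..X}"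
    by (rule has_integral_diff)
  moreover have "(h2 x * u x + h1 x * u' x) - (h2 0 + G (h 0)) * u x = h1 x * u' x - G (h x) * u x" for x
    unfolding first_integral[of x, symmetric] by (simp add: algebra_simps)
  ultimately show ?thesis by simp
qed

text \<open>The remainder evaluates \<open>r\<close> at an intermediate point, so uniform continuity
  of \<open>r\<close> will control it. The case \<open>b = a\<close> is separate because Taylor's
  formula asks for distinct points.\<close>

lemma Taylor2:
  assumes "0 < a" "0 < b"
  obtains t where "\<bar>t - a\<bar> \<le> \<bar>b - a\<bar>" "min a b \<le> t" "t \<le> max a b"
    "H b = H a + G a * (b - a) + r t * (b - a)\<^sup>2 / 2"
proof (cases "b = a")
  case True
  then show ?thesis using that[of a] by simp
next
  case False
  define D where "D = (\<lambda>m::nat. if m = 0 then H else if m = 1 then G else r)"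
  have "\<exists>t. (if b < a then b < t \<and> t < a else a < t \<and> t < b) \<and>
      H b = (\<Sum>m<2. (D m a / fact m) * (b - a)^m) + (D 2 t / fact 2) * (b - a)^2"
  proof (rule Taylor[where a = "min a b" and b = "max a b"])
    show "\<forall>m t. m < 2 \<and> min a b \<le> t \<and> t \<le> max a b \<longrightarrow> (D m has_real_derivative D (Suc m) t) (at t)"
      using assms dH dG by (auto simp: D_def less_Suc_eq numeral_2_eq_2)
  qed (use False in \<open>auto simp: D_def\<close>)
  then obtain t where t: "if b < a then b < t \<and> t < a else a < t \<and> t < b"
    "H b = (\<Sum>m<2. (D m a / fact m) * (b - a)^m) + (D 2 t / fact 2) * (b - a)^2" by blast
  have "H b = H a + G a * (b - a) + r t * (b - a)\<^sup>2 / 2"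
    using t(2) by (simp add: D_def numeral_2_eq_2)
  then show ?thesis using that[of t] t(1) by (auto split: if_splits)
qed

text \<open>The Lagrange remainder \<open>r2 t * (b - a)^4 / 24\<close> is positive, however far
  apart \<open>a\<close> and \<open>b\<close> are.\<close>

lemma Taylor4:
  assumes "0 < a" "0 < b" "a \<noteq> b" "\<forall>y>0. 0 < r2 y"
  shows "H a + G a * (b - a) + r a * (b - a)\<^sup>2 / 2 + r1 a * (b - a)^3 / 6 < H b"
proof -
  define D where "D = (\<lambda>m::nat. if m = 0 then H else if m = 1 then G else if m = 2 then r
    else if m = 3 then r1 else r2)"
  have "\<exists>t. (if b < a then b < t \<and> t < a else a < t \<and> t < b) \<and>
      H b = (\<Sum>m<4. (D m a / fact m) * (b - a)^m) + (D 4 t / fact 4) * (b - a)^4"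
  proof (rule Taylor[where a = "min a b" and b = "max a b"])
    show "\<forall>m t. m < 4 \<and> min a b \<le> t \<and> t \<le> max a b \<longrightarrow> (D m has_real_derivative D (Suc m) t) (at t)"
    proof (intro allI impI)
      fix m :: nat and t assume "m < 4 \<and> min a b \<le> t \<and> t \<le> max a b"
      then have "m = 0 \<or> m = 1 \<or> m = 2 \<or> m = 3" "0 < t" using assms(1,2) by auto
      then show "(D m has_real_derivative D (Suc m) t) (at t)"
        using dH dG dr dr1 by (auto simp: D_def)
    qed
  qed (use assms in \<open>auto simp: D_def\<close>)
  then obtain t where t: "if b < a then b < t \<and> t < a else a < t \<and> t < b"
    "H b = (\<Sum>m<4. (D m a / fact m) * (b - a)^m) + (D 4 t / fact 4) * (b - a)^4" by blast
  have "0 < r2 t" using t(1) assms by (auto split: if_splits)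
  then have "0 < (D 4 t / fact 4) * (b - a)^4"
    using assms(3) by (simp add: D_def)
  moreover have "(\<Sum>m<4. (D m a / fact m) * (b - a)^m) =
      H a + G a * (b - a) + r a * (b - a)\<^sup>2 / 2 + r1 a * (b - a)^3 / 6"
    by (simp add: D_def eval_nat_numeral fact_numeral)
  ultimately show ?thesis using t(2) by simp
qed

text \<open>The first variation vanishes, so the energy changes by half of
  \<open>\<epsilon>^2\<close> times \<open>Q u u'\<close>, up to the oscillation of \<open>r\<close>
  between \<open>h\<close> and the perturbed function. Keeping that oscillation below a fixed
  \<open>\<eta>\<close> makes the estimate uniform in \<open>x\<close>.\<close>

lemma energy_unstable_of_Q_neg:
  assumes u: "\<And>x. (u has_real_derivative u' x) (at x)" "continuous_on UNIV u'"
    "periodic_fun_simple u X" "integral {0..X} u = 0" and Q: "Q u u' < 0"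
  shows "energy_unstable_in_direction H X h u"
  unfolding energy_unstable_in_direction_def
proof
  show "u \<in> H1_mean_zero X" using u by (rule H1_mean_zeroI)
  have cu: "continuous_on S u" for S
    using u(1) by (meson DERIV_isCont continuous_at_imp_continuous_on)
  have cu': "continuous_on S u'" for S using u(2) continuous_on_subset by blast
  obtain m where m: "0 < m" "\<And>x. m \<le> h x"
    using periodic_lower_bound[OF X cont_h per hpos] by blast
  obtain M where M: "0 < M" "\<And>x. \<bar>h x\<bar> \<le> M" using periodic_bounded[OF X cont_h per] by blast
  obtain U where U: "0 < U" "\<And>x. \<bar>u x\<bar> \<le> U" using periodic_bounded[OF X cu u(3)] by blast
  define S where "S = integral {0..X} (\<lambda>x. (u x)\<^sup>2)"
  have S: "0 \<le> S"
    unfolding S_def by (intro integral_nonneg integrable_continuous_real continuous_intros cu) auto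
  \<comment> \<open>The error \<open>\<eta> * S\<close> may consume at most half of
    \<open>- Q u u'\<close>; the added 1 covers the case where \<open>S\<close> vanishes.\<close>
  define \<eta> where "\<eta> = - Q u u' / (2 * (S + 1))"
  have \<eta>: "0 < \<eta>" "Q u u' + \<eta> * S < 0"
  proof -
    show "0 < \<eta>" using Q S by (simp add: \<eta>_def divide_neg_pos)
    have "\<eta> * S \<le> \<eta> * (S + 1)" using \<open>0 < \<eta>\<close> by simp
    also have "\<dots> = - Q u u' / 2" using S by (simp add: \<eta>_def nonzero_eq_divide_eq field_simps add_nonneg_eq_0_iff)
    finally show "Q u u' + \<eta> * S < 0" using Q by simp
  qed
  \<comment> \<open>The values of \<open>h\<close> lie in \<open>[m, M]\<close>. Perturbations of
    size at most \<open>m / 2\<close> remain in this interval, which keeps away from 0.\<close>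
  have "uniformly_continuous_on {m/2..M + m} r"
    using m(1) by (intro compact_uniformly_continuous continuous_on_subset[OF continuous_potentials(3)]) auto
  then obtain d where d: "0 < d" "\<And>y z. y \<in> {m/2..M + m} \<Longrightarrow> z \<in> {m/2..M + m} \<Longrightarrow> \<bar>z - y\<bar> < d \<Longrightarrow>
      \<bar>r z - r y\<bar> < \<eta>"
    unfolding uniformly_continuous_on_def dist_real_def using \<eta>(1) by meson
  define \<epsilon>0 where "\<epsilon>0 = min (m / (2 * U)) (d / (2 * U))"
  have "0 < \<epsilon>0" using m(1) d(1) U(1) by (simp add: \<epsilon>0_def)
  then show "\<forall>\<^sub>F \<epsilon> in at_right 0. (\<forall>x. 0 < h x + \<epsilon> * u x) \<and> energy H X (\<lambda>x. h x + \<epsilon> * u x) < energy H X h"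
  proof (rule eventually_at_rightI[rotated])
    fix \<epsilon> assume "\<epsilon> \<in> {0<..<\<epsilon>0}"
    then have e: "0 < \<epsilon>" "\<epsilon> < m / (2 * U)" "\<epsilon> < d / (2 * U)" by (auto simp: \<epsilon>0_def)
    have small: "\<bar>\<epsilon> * u x\<bar> \<le> m / 2" "\<bar>\<epsilon> * u x\<bar> < d" for x
    proof -
      have "\<bar>\<epsilon> * u x\<bar> \<le> \<epsilon> * U" using e(1) U(2) by (simp add: abs_mult)
      moreover have "\<epsilon> * U \<le> m / 2" "\<epsilon> * U \<le> d / 2" using e U(1) by (simp_all add: field_simps)
      ultimately show "\<bar>\<epsilon> * u x\<bar> \<le> m / 2" "\<bar>\<epsilon> * u x\<bar> < d" using d(1) by linarith+
    qed
    have pos: "0 < h x + \<epsilon> * u x" for x using small(1)[of x] m(1) m(2)[of x] by linarith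
    have pw: "(h1 x + \<epsilon> * u' x)\<^sup>2 / 2 - H (h x + \<epsilon> * u x) \<le> ((h1 x)\<^sup>2 / 2 - H (h x)) +
        \<epsilon> * (h1 x * u' x - G (h x) * u x) +
        \<epsilon>\<^sup>2 / 2 * (((u' x)\<^sup>2 - r (h x) * (u x)\<^sup>2) + \<eta> * (u x)\<^sup>2)" for x
    proof -
      obtain t where t: "\<bar>t - h x\<bar> \<le> \<bar>\<epsilon> * u x\<bar>" "min (h x) (h x + \<epsilon> * u x) \<le> t" "t \<le> max (h x) (h x + \<epsilon> * u x)"
          "H (h x + \<epsilon> * u x) = H (h x) + G (h x) * (\<epsilon> * u x) + r t * (\<epsilon> * u x)\<^sup>2 / 2"
        using Taylor2[OF hpos[of x] pos[of x]] by auto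
      have "\<bar>r t - r (h x)\<bar> < \<eta>"
      proof (rule d(2))
        show "h x \<in> {m / 2..M + m}" "t \<in> {m / 2..M + m}" "\<bar>t - h x\<bar> < d"
          using m(1) m(2)[of x] M(2)[of x] small[of x] t(1-3) by auto
      qed
      then have "r (h x) - \<eta> \<le> r t" by linarith
      then have "(r (h x) - \<eta>) * (\<epsilon> * u x)\<^sup>2 \<le> r t * (\<epsilon> * u x)\<^sup>2" by (rule mult_right_mono) simp
      then show ?thesis
        unfolding t(4) by (simp add: field_simps power2_eq_square)
    qed
    have "energy H X (\<lambda>x. h x + \<epsilon> * u x) =
        integral {0..X} (\<lambda>x. (h1 x + \<epsilon> * u' x)\<^sup>2 / 2 - H (h x + \<epsilon> * u x))"
    proof (rule energy_C1[OF _ _ _ pos])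
      show "((\<lambda>x. h x + \<epsilon> * u x) has_real_derivative h1 x + \<epsilon> * u' x) (at x)" for x
        using dh[of x] u(1)[of x] by (auto intro!: derivative_eq_intros)
      show "continuous_on UNIV (\<lambda>x. h1 x + \<epsilon> * u' x)" by (intro continuous_intros cont cu')
      show "periodic_fun_simple (\<lambda>x. h x + \<epsilon> * u x) X"
        using periodic_funD[OF u(3)] by (intro periodic_funI) simp
    qed
    also have "\<dots> \<le> integral {0..X} (\<lambda>x. ((h1 x)\<^sup>2 / 2 - H (h x)) +
        \<epsilon> * (h1 x * u' x - G (h x) * u x) +
        \<epsilon>\<^sup>2 / 2 * (((u' x)\<^sup>2 - r (h x) * (u x)\<^sup>2) + \<eta> * (u x)\<^sup>2))"
    proof (rule integral_le[OF _ _ pw])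
      have "continuous_on {0..X} (\<lambda>x. H (h x + \<epsilon> * u x))"
        by (rule continuous_on_compose2[OF continuous_potentials(1)])
           (use pos in \<open>auto intro!: continuous_intros cont cu\<close>)
      then show "(\<lambda>x. (h1 x + \<epsilon> * u' x)\<^sup>2 / 2 - H (h x + \<epsilon> * u x)) integrable_on {0..X}"
        by (intro integrable_continuous_real continuous_intros cont cu') auto
      show "(\<lambda>x. ((h1 x)\<^sup>2 / 2 - H (h x)) + \<epsilon> * (h1 x * u' x - G (h x) * u x) +
          \<epsilon>\<^sup>2 / 2 * (((u' x)\<^sup>2 - r (h x) * (u x)\<^sup>2) + \<eta> * (u x)\<^sup>2)) integrable_on {0..X}"
        by (intro integrable_continuous_real continuous_intros cont cu cu') auto
    qed
    also have "\<dots> = energy H X h + \<epsilon>\<^sup>2 / 2 * (Q u u' + \<eta> * S)"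
    proof (rule integral_unique)
      have hi: "(f has_integral integral {0..X} f) {0..X}" if "continuous_on {0..X} f" for f :: "real \<Rightarrow> real"
        by (intro integrable_integral integrable_continuous_real that)
      have "((\<lambda>x. (h1 x)\<^sup>2 / 2 - H (h x)) has_integral energy H X h) {0..X}"
        unfolding energy_C1[OF dh cont_h1 per hpos] by (intro hi continuous_intros cont) auto
      moreover have "((\<lambda>x. (u' x)\<^sup>2 - r (h x) * (u x)\<^sup>2) has_integral Q u u') {0..X}"
        unfolding Q_def by (intro hi continuous_intros cont cu cu')
      moreover have "((\<lambda>x. (u x)\<^sup>2) has_integral S) {0..X}"
        unfolding S_def by (intro hi continuous_intros cu)
      moreover note first_variation[OF u]
      ultimately have "((\<lambda>x. ((h1 x)\<^sup>2 / 2 - H (h x)) +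
        \<epsilon> * (h1 x * u' x - G (h x) * u x) +
        \<epsilon>\<^sup>2 / 2 * (((u' x)\<^sup>2 - r (h x) * (u x)\<^sup>2) + \<eta> * (u x)\<^sup>2)) has_integral
        (energy H X h + \<epsilon> * 0 + \<epsilon>\<^sup>2 / 2 * (Q u u' + \<eta> * S))) {0..X}"
        by (intro has_integral_add has_integral_mult_right)
      then show "((\<lambda>x. ((h1 x)\<^sup>2 / 2 - H (h x)) +
        \<epsilon> * (h1 x * u' x - G (h x) * u x) +
        \<epsilon>\<^sup>2 / 2 * (((u' x)\<^sup>2 - r (h x) * (u x)\<^sup>2) + \<eta> * (u x)\<^sup>2)) has_integral
        (energy H X h + \<epsilon>\<^sup>2 / 2 * (Q u u' + \<eta> * S))) {0..X}" by simp
    qed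
    also have "\<dots> < energy H X h" using \<eta>(2) e(1) by (simp add: mult_pos_neg)
    finally show "(\<forall>x. 0 < h x + \<epsilon> * u x) \<and> energy H X (\<lambda>x. h x + \<epsilon> * u x) < energy H X h"
      using pos by blast
  qed
qed

lemma energy_unstable_of_negative_direction:
  assumes "negative_direction X (\<lambda>x. r (h x)) \<phi>"
  shows "energy_unstable H X h"
proof -
  have \<phi>: "smooth \<phi>" "periodic_fun_simple \<phi> X" "integral {0..X} \<phi> = 0" "Q \<phi> (deriv \<phi>) < 0"
    using assms by (auto simp: negative_direction_def Q_def)
  have "energy_unstable_in_direction H X h \<phi>"
    using \<phi> by (intro energy_unstable_of_Q_neg[OF smooth_has_deriv[OF \<phi>(1)]])
      (auto simp: smooth_continuous smooth_deriv)
  with \<phi>(1) show ?thesis by (auto simp: energy_unstable_def)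
qed

end

subsection \<open>Directions generated by derivatives of the steady state\<close>

text \<open>It has three uses: critical points of \<open>h\<close>, nodes of \<open>h'\<close>
  within any open interval of one period, and the vanishing of the constant of integration in the
  steady state equation.\<close>

lemma Rolle_periodic:
  fixes F :: "real \<Rightarrow> real"
  assumes "0 < P" "periodic_fun_simple F P" "\<And>x. (F has_real_derivative f x) (at x)"
  obtains z where "a < z" "z < a + P" "f z = 0"
proof -
  have "\<exists>z. a < z \<and> z < a + P \<and> DERIV F z :> 0"
  proof (rule Rolle)
    show "F a = F (a + P)" using periodic_funD[OF assms(2)] by simp
    show "continuous_on {a..a + P} F"
      using assms(3) by (meson DERIV_isCont continuous_at_imp_continuous_on)
    show "F differentiable (at x)" for x using assms(3) real_differentiable_def by blast
  qed (use assms in simp)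
  then show ?thesis using that assms(3) DERIV_unique by blast
qed

context steady_state
begin

lemma h1_nonzero:
  assumes "\<not> h constant_on UNIV"
  obtains x where "x \<in> {0..X}" "h1 x \<noteq> 0"
proof -
  have "\<exists>x. h1 x \<noteq> 0"
  proof (rule ccontr)
    assume "\<not> (\<exists>x. h1 x \<noteq> 0)"
    then have "(h has_real_derivative 0) (at x)" for x using dh[of x] by simp
    then have "h x = h 0" for x by (intro DERIV_isconst_all) blast
    with assms show False by (auto simp: constant_on_def)
  qed
  then obtain x where x: "h1 x \<noteq> 0" by blast
  obtain y where "0 \<le> y" "y \<le> X" "h1 x = h1 y"
    using periodic_reduce[OF X] periodic(1) by metis
  with x that show ?thesis by auto
qed

lemma has_integral_h1: "(h1 has_integral 0) {0..X}" and has_integral_h2: "(h2 has_integral 0) {0..X}"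
  using FTC_periodic[OF less_imp_le[OF X] dh per] FTC_periodic[OF less_imp_le[OF X] dh1 periodic(1)] .

text \<open>Translation invariance puts \<open>h1\<close> in the kernel of the linearised operator,
  so the integrand of the second variation is the derivative of \<open>h1 * h2\<close>.\<close>

lemma Q_h1: "((\<lambda>x. (h2 x)\<^sup>2 - r (h x) * (h1 x)\<^sup>2) has_integral 0) {0..X}"
proof (rule FTC_periodic)
  show "((\<lambda>x. h1 x * h2 x) has_real_derivative (h2 x)\<^sup>2 - r (h x) * (h1 x)\<^sup>2) (at x)" for x
    using dh1[of x] dh2[of x] by (auto intro!: derivative_eq_intros simp: power2_eq_square)
qed (use X in \<open>auto intro: periodic_funI\<close>)

text \<open>In the derivative of \<open>r(h) * h1^2 + h2^2\<close> the two mixed terms cancel by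
  \<open>dh2\<close>, leaving the integrand of the third variation.\<close>

lemma cubic_h1: "((\<lambda>x. r1 (h x) * (h1 x)^3) has_integral 0) {0..X}"
proof (rule FTC_periodic)
  show "((\<lambda>x. r (h x) * (h1 x)\<^sup>2 + (h2 x)\<^sup>2) has_real_derivative r1 (h x) * (h1 x)^3) (at x)" for x
    using dh1[of x] dh2[of x] chain(2)[of x]
    by (auto intro!: derivative_eq_intros simp: eval_nat_numeral)
qed (use X in \<open>auto intro: periodic_funI\<close>)

text \<open>Integrating by parts twice trades the form at \<open>h2\<close> for \<open>r2\<close>.
  Both boundary terms are collected in the one periodic antiderivative below, in whose derivative
  the terms with \<open>r1\<close> cancel.\<close>

lemma Q_h2:
  "((\<lambda>x. ((r (h x) * h1 x)\<^sup>2 - r (h x) * (h2 x)\<^sup>2) + r2 (h x) * (h1 x)^4 / 3) has_integral 0) {0..X}"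
proof (rule FTC_periodic)
  show "((\<lambda>x. r1 (h x) * (h1 x)^3 / 3 - r (h x) * h1 x * h2 x) has_real_derivative
      ((r (h x) * h1 x)\<^sup>2 - r (h x) * (h2 x)\<^sup>2) + r2 (h x) * (h1 x)^4 / 3) (at x)" for x
    using dh1[of x] dh2[of x] chain(2,3)[of x]
    by (auto intro!: derivative_eq_intros simp: eval_nat_numeral algebra_simps)
qed (use X in \<open>auto intro: periodic_funI\<close>)

lemma integral_Q_h2:
  "integral {0..X} (\<lambda>x. (r (h x) * h1 x)\<^sup>2 - r (h x) * (h2 x)\<^sup>2) =
   - integral {0..X} (\<lambda>x. r2 (h x) * (h1 x)^4 / 3)"
proof -
  have "integral {0..X} (\<lambda>x. ((r (h x) * h1 x)\<^sup>2 - r (h x) * (h2 x)\<^sup>2) + r2 (h x) * (h1 x)^4 / 3) =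
      integral {0..X} (\<lambda>x. (r (h x) * h1 x)\<^sup>2 - r (h x) * (h2 x)\<^sup>2) +
      integral {0..X} (\<lambda>x. r2 (h x) * (h1 x)^4 / 3)"
    by (intro integral_add integrable_continuous_real continuous_intros cont) auto
  then show ?thesis using integral_unique[OF Q_h2] by simp
qed

lemma integral_r2_pos:
  assumes "\<not> h constant_on UNIV" "\<forall>y>0. 0 < r2 y"
  shows "0 < integral {0..X} (\<lambda>x. r2 (h x) * (h1 x)^4 / 3)"
proof -
  obtain c where c: "c \<in> {0..X}" "h1 c \<noteq> 0" using h1_nonzero[OF assms(1)] .
  show ?thesis
  proof (rule integral_pos_continuous[OF X _ _ c(1)])
    show "continuous_on {0..X} (\<lambda>x. r2 (h x) * (h1 x)^4 / 3)" by (intro continuous_intros cont) auto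
    show "0 \<le> r2 (h x) * (h1 x)^4 / 3" for x
      using assms(2) hpos[of x] by (simp add: less_imp_le)
    show "r2 (h c) * (h1 c)^4 / 3 \<noteq> 0"
      using assms(2) hpos[of c] c(2) by (simp add: less_imp_neq[symmetric])
  qed
qed

lemma energy_unstable_h2:
  assumes "\<not> h constant_on UNIV" "\<forall>y>0. 0 < r2 y" "c \<noteq> 0"
  shows "energy_unstable_in_direction H X h (\<lambda>x. c * h2 x)"
proof (rule energy_unstable_of_Q_neg)
  show "((\<lambda>x. c * h2 x) has_real_derivative c * - (r (h x) * h1 x)) (at x)" for x
    by (rule DERIV_cmult[OF dh2])
  show "continuous_on UNIV (\<lambda>x. c * - (r (h x) * h1 x))" by (intro continuous_intros cont)
  show "periodic_fun_simple (\<lambda>x. c * h2 x) X" by (intro periodic_funI) simp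
  show "integral {0..X} (\<lambda>x. c * h2 x) = 0" using integral_unique[OF has_integral_h2] by simp
  have "Q (\<lambda>x. c * h2 x) (\<lambda>x. c * - (r (h x) * h1 x)) =
      integral {0..X} (\<lambda>x. c\<^sup>2 * ((r (h x) * h1 x)\<^sup>2 - r (h x) * (h2 x)\<^sup>2))"
    unfolding Q_def by (simp add: algebra_simps power_mult_distrib)
  also have "\<dots> = c\<^sup>2 * integral {0..X} (\<lambda>x. (r (h x) * h1 x)\<^sup>2 - r (h x) * (h2 x)\<^sup>2)"
    by (rule integral_mult_right)
  also have "\<dots> < 0"
    unfolding integral_Q_h2 using integral_r2_pos[OF assms(1,2)] assms(3)
    by (simp add: zero_less_mult_iff)
  finally show "Q (\<lambda>x. c * h2 x) (\<lambda>x. c * - (r (h x) * h1 x)) < 0" .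
qed

text \<open>
  Along \<open>h'\<close> the energy has vanishing first, second and third variations, so that the sign of
  \<open>H'''' = r''\<close> decides.
\<close>

lemma energy_unstable_h1:
  assumes "\<not> h constant_on UNIV" "\<forall>y>0. 0 < r2 y" "c \<noteq> 0"
  shows "energy_unstable_in_direction H X h (\<lambda>x. c * h1 x)"
  unfolding energy_unstable_in_direction_def
proof
  have du: "((\<lambda>x. c * h1 x) has_real_derivative c * h2 x) (at x)" for x
    by (rule DERIV_cmult[OF dh1])
  have cu': "continuous_on UNIV (\<lambda>x. c * h2 x)" by (intro continuous_intros cont)
  have pu: "periodic_fun_simple (\<lambda>x. c * h1 x) X" by (intro periodic_funI) simp
  have iu: "integral {0..X} (\<lambda>x. c * h1 x) = 0" using integral_unique[OF has_integral_h1] by simp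
  show "(\<lambda>x. c * h1 x) \<in> H1_mean_zero X" by (rule H1_mean_zeroI[OF du cu' pu iu])
  obtain m where m: "0 < m" "\<And>x. m \<le> h x"
    using periodic_lower_bound[OF X cont_h per hpos] by blast
  obtain U where U: "0 < U" "\<And>x. \<bar>c * h1 x\<bar> \<le> U"
    using periodic_bounded[OF X continuous_on_mult_left[OF cont_h1] pu] by blast
  obtain z where z: "z \<in> {0..X}" "h1 z \<noteq> 0" using h1_nonzero[OF assms(1)] .
  \<comment> \<open>Only positivity of the perturbed function restricts \<open>\<epsilon>\<close>,
    because the remainder in \<open>Taylor4\<close> has a sign at every distance.\<close>
  have "0 < m / U" using m U by simp
  then show "\<forall>\<^sub>F \<epsilon> in at_right 0. (\<forall>x. 0 < h x + \<epsilon> * (c * h1 x)) \<and>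
      energy H X (\<lambda>x. h x + \<epsilon> * (c * h1 x)) < energy H X h"
  proof (rule eventually_at_rightI[rotated])
    fix \<epsilon> assume "\<epsilon> \<in> {0<..<m / U}"
    then have e: "0 < \<epsilon>" "\<epsilon> * U < m" using U(1) by (auto simp: field_simps)
    have pos: "0 < h x + \<epsilon> * (c * h1 x)" for x
    proof -
      have "\<bar>\<epsilon> * (c * h1 x)\<bar> \<le> \<epsilon> * U" using e(1) U(2)[of x] by (subst abs_mult) simp
      then show ?thesis using e(2) m(2)[of x] by linarith
    qed
    define f where "f = (\<lambda>x. (h1 x + \<epsilon> * (c * h2 x))\<^sup>2 / 2 - H (h x + \<epsilon> * (c * h1 x)))"
    \<comment> \<open>This is the energy density expanded to third order in
      \<open>\<epsilon>\<close>. All its corrections integrate to zero, so its integral is the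
      unperturbed energy, while \<open>Taylor4\<close> places it strictly above \<open>f\<close>
      wherever \<open>h1\<close> is nonzero.\<close>
    define g where "g = (\<lambda>x. ((h1 x)\<^sup>2 / 2 - H (h x)) +
        \<epsilon> * (h1 x * (c * h2 x) - G (h x) * (c * h1 x)) +
        (\<epsilon> * c)\<^sup>2 / 2 * ((h2 x)\<^sup>2 - r (h x) * (h1 x)\<^sup>2) - (\<epsilon> * c)^3 / 6 * (r1 (h x) * (h1 x)^3))"
    have gf: "g x - f x = H (h x + \<epsilon> * (c * h1 x)) - (H (h x) + G (h x) * (\<epsilon> * (c * h1 x)) +
        r (h x) * (\<epsilon> * (c * h1 x))\<^sup>2 / 2 + r1 (h x) * (\<epsilon> * (c * h1 x))^3 / 6)" for x
      by (simp add: f_def g_def power_mult_distrib field_simps power2_sum)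
    have strict: "f x < g x" if "h1 x \<noteq> 0" for x
      using Taylor4[OF hpos[of x] pos[of x] _ assms(2)] that e(1) assms(3) gf[of x] by simp
    have cf: "continuous_on {0..X} f"
    proof -
      have "continuous_on {0..X} (\<lambda>x. H (h x + \<epsilon> * (c * h1 x)))"
        by (rule continuous_on_compose2[OF continuous_potentials(1)])
           (use pos in \<open>auto intro!: continuous_intros cont\<close>)
      then show ?thesis unfolding f_def by (intro continuous_intros cont) auto
    qed
    have cg: "continuous_on {0..X} g" unfolding g_def by (intro continuous_intros cont) auto
    have "0 < integral {0..X} (\<lambda>x. g x - f x)"
    proof (rule integral_pos_continuous[OF X _ _ z(1)])
      show "continuous_on {0..X} (\<lambda>x. g x - f x)" by (intro continuous_intros cf cg)
      show "0 \<le> g x - f x" for x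
        using strict[of x] gf[of x] by (cases "h1 x = 0") (auto simp del: mult_eq_0_iff)
      show "g z - f z \<noteq> 0" using strict[OF z(2)] by simp
    qed
    then have "integral {0..X} f < integral {0..X} g"
      using cf cg by (simp add: integral_diff integrable_continuous_real)
    moreover have "(g has_integral energy H X h + \<epsilon> * 0 + (\<epsilon> * c)\<^sup>2 / 2 * 0 - (\<epsilon> * c)^3 / 6 * 0) {0..X}"
      unfolding g_def
    proof (intro has_integral_add has_integral_diff has_integral_mult_right)
      show "((\<lambda>x. (h1 x)\<^sup>2 / 2 - H (h x)) has_integral energy H X h) {0..X}"
        unfolding energy_C1[OF dh cont_h1 per hpos]
        by (intro integrable_integral integrable_continuous_real continuous_intros cont) auto
      show "((\<lambda>x. h1 x * (c * h2 x) - G (h x) * (c * h1 x)) has_integral 0) {0..X}"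
        by (rule first_variation[OF du cu' pu iu])
    qed (rule Q_h1 cubic_h1)+
    moreover have "energy H X (\<lambda>x. h x + \<epsilon> * (c * h1 x)) = integral {0..X} f"
      unfolding f_def
    proof (rule energy_C1[OF _ _ _ pos])
      show "((\<lambda>x. h x + \<epsilon> * (c * h1 x)) has_real_derivative h1 x + \<epsilon> * (c * h2 x)) (at x)" for x
        using dh[of x] dh1[of x] by (auto intro!: derivative_eq_intros)
      show "continuous_on UNIV (\<lambda>x. h1 x + \<epsilon> * (c * h2 x))" by (intro continuous_intros cont)
      show "periodic_fun_simple (\<lambda>x. h x + \<epsilon> * (c * h1 x)) X" by (intro periodic_funI) simp
    qed
    ultimately show "(\<forall>x. 0 < h x + \<epsilon> * (c * h1 x)) \<and>
        energy H X (\<lambda>x. h x + \<epsilon> * (c * h1 x)) < energy H X h"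
      using pos by (auto dest: integral_unique)
  qed
qed

text \<open>
  The perturbation \<open>w\<close> is the gradient of the form at \<open>h''\<close>, which is the projection of
  \<open>r'(h) (h')\<^sup>2\<close> onto the mean-zero functions.
\<close>

lemma energy_unstable_convex:
  assumes r2: "\<forall>y>0. 0 \<le> r2 y" and nc: "\<not> r constant_on range h"
  shows "energy_unstable H X h"
proof -
  let ?v = "\<lambda>x. - (r (h x) * h1 x)"
  define m where "m = integral {0..X} (\<lambda>x. r1 (h x) * (h1 x)\<^sup>2) / X"
  define w where "w = (\<lambda>x. r1 (h x) * (h1 x)\<^sup>2 - m)"
  define w' where "w' = (\<lambda>x. r2 (h x) * (h1 x)^3 + 2 * r1 (h x) * h1 x * h2 x)"
  have dw: "(w has_real_derivative w' x) (at x)" for x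
    unfolding w_def w'_def using dh1[of x] chain(3)[of x]
    by (auto intro!: derivative_eq_intros simp: eval_nat_numeral)
  have cw: "continuous_on S w" for S unfolding w_def by (intro continuous_intros cont)
  have cw': "continuous_on S w'" for S unfolding w'_def by (intro continuous_intros cont)
  have cv: "continuous_on S ?v" for S by (intro continuous_intros cont)
  have pw: "periodic_fun_simple w X" by (intro periodic_funI) (simp add: w_def)
  have "integral {0..X} w = integral {0..X} (\<lambda>x. r1 (h x) * (h1 x)\<^sup>2) - integral {0..X} (\<lambda>x. m)"
    unfolding w_def by (intro integral_diff integrable_continuous_real continuous_intros cont)
  then have iw: "integral {0..X} w = 0" using X by (simp add: m_def)
  have sq: "square_integrable X h2" "square_integrable X ?v"
    by (intro square_integrable_continuous cont cv)+
  \<comment> \<open>The derivative of \<open>?v * w\<close> moves the derivative off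
    \<open>w\<close> and leaves \<open>r1(h) * h1^2 * w\<close>, which is
    \<open>w^2 + m * w\<close>; the last term has integral zero.\<close>
  have grad: "inprod X ?v w' - inprod X (\<lambda>x. r (h x) * h2 x) w = integral {0..X} (\<lambda>x. (w x)\<^sup>2)"
  proof -
    have "((\<lambda>x. (?v x * w' x - r (h x) * h2 x * w x) - r1 (h x) * (h1 x)\<^sup>2 * w x) has_integral 0) {0..X}"
    proof (rule FTC_periodic)
      show "((\<lambda>x. ?v x * w x) has_real_derivative
          (?v x * w' x - r (h x) * h2 x * w x) - r1 (h x) * (h1 x)\<^sup>2 * w x) (at x)" for x
        using dw[of x] dh1[of x] chain(2)[of x]
        by (auto intro!: derivative_eq_intros simp: algebra_simps power2_eq_square)
    qed (use X periodic_funD[OF pw] in \<open>auto intro: periodic_funI\<close>)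
    moreover have "((\<lambda>x. m * w x) has_integral m * 0) {0..X}"
      using iw cw by (intro has_integral_mult_right)
        (metis has_integral_integral integrable_continuous_real)
    ultimately have "((\<lambda>x. ((?v x * w' x - r (h x) * h2 x * w x) - r1 (h x) * (h1 x)\<^sup>2 * w x) + m * w x)
        has_integral 0 + m * 0) {0..X}"
      by (rule has_integral_add)
    then have "((\<lambda>x. (?v x * w' x - r (h x) * h2 x * w x) - (w x)\<^sup>2) has_integral 0) {0..X}"
      by (simp add: w_def algebra_simps power2_eq_square)
    then have "integral {0..X} (\<lambda>x. (?v x * w' x - r (h x) * h2 x * w x) - (w x)\<^sup>2) = 0"
      by (rule integral_unique)
    moreover have "integral {0..X} (\<lambda>x. (?v x * w' x - r (h x) * h2 x * w x) - (w x)\<^sup>2) =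
        integral {0..X} (\<lambda>x. ?v x * w' x) - integral {0..X} (\<lambda>x. r (h x) * h2 x * w x) -
        integral {0..X} (\<lambda>x. (w x)\<^sup>2)"
    proof -
      have i: "(\<lambda>x. ?v x * w' x) integrable_on {0..X}" "(\<lambda>x. r (h x) * h2 x * w x) integrable_on {0..X}"
          "(\<lambda>x. (w x)\<^sup>2) integrable_on {0..X}"
        by (intro integrable_continuous_real continuous_intros cont cw cw')+
      show ?thesis
        unfolding integral_diff[OF integrable_diff[OF i(1,2)] i(3)] integral_diff[OF i(1,2)] ..
    qed
    ultimately show ?thesis
      using inprod_continuous[OF cv cw', of X]
        inprod_continuous[OF continuous_on_mult[OF cont(6) cont(3)] cw, of X] by simp
  qed
  have ne: "integral {0..X} (\<lambda>x. (w x)\<^sup>2) \<noteq> 0"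
  proof
    assume 0: "integral {0..X} (\<lambda>x. (w x)\<^sup>2) = 0"
    have w0: "w x = 0" for x
    proof -
      obtain y where y: "0 \<le> y" "y \<le> X" "w x = w y"
        using periodic_reduce[OF X] pw by metis
      have "w y = 0"
      proof (rule ccontr)
        assume "w y \<noteq> 0"
        then have "0 < integral {0..X} (\<lambda>x. (w x)\<^sup>2)"
          using y by (intro integral_pos_continuous[OF X, of _ y] continuous_intros cw) auto
        with 0 show False by simp
      qed
      with y show ?thesis by simp
    qed
    \<comment> \<open>If \<open>w\<close> vanished identically, then \<open>r1(h) * h1^2\<close>
      would be the constant \<open>m\<close>. At a critical point of \<open>h\<close> this constant
      is 0, so the derivative of \<open>r(h)\<close> is zero everywhere, contradicting
      \<open>nc\<close>.\<close>
    obtain z where "h1 z = 0" using Rolle_periodic[OF X per dh, of 0] by metis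
    then have "m = 0" using w0[of z] by (simp add: w_def)
    then have "r1 (h x) * h1 x = 0" for x using w0[of x] by (simp add: w_def)
    then have "((\<lambda>x. r (h x)) has_real_derivative 0) (at x)" for x using chain(2)[of x] by (simp only:)
    then have "r (h x) = r (h 0)" for x by (intro DERIV_isconst_all[of "\<lambda>x. r (h x)"]) blast
    with nc show False by (auto simp: constant_on_def)
  qed
  have "\<exists>\<phi>. negative_direction X (\<lambda>x. r (h x)) \<phi>"
  proof (rule negative_direction_of_noncritical[OF X _ sq _ _ _ dw cw' pw iw])
    show "continuous_on {0..X} (\<lambda>x. r (h x))" by (rule cont)
    show "is_weak_deriv X h2 ?v"
      using X dh2 sq shift(3)[of 0]
      by (intro is_weak_deriv_piecewise[where S = "{}"] cont) auto
    show "inprod X h2 (\<lambda>_. 1) = 0"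
      using integral_unique[OF has_integral_h2] by (simp add: inprod_continuous cont)
    have "0 \<le> integral {0..X} (\<lambda>x. r2 (h x) * (h1 x)^4 / 3)"
      using r2 hpos by (intro integral_nonneg integrable_continuous_real continuous_intros cont) auto
    moreover have "integral {0..X} (\<lambda>x. (r (h x) * h1 x)\<^sup>2 - r (h x) * (h2 x)\<^sup>2) =
        integral {0..X} (\<lambda>x. ?v x * ?v x) - integral {0..X} (\<lambda>x. r (h x) * h2 x * h2 x)"
      by (subst integral_diff[symmetric])
         (auto simp: power2_eq_square mult_ac intro!: integrable_continuous_real continuous_intros cont)
    ultimately show "inprod X ?v ?v - inprod X (\<lambda>x. r (h x) * h2 x) h2 \<le> 0"
      using inprod_continuous[OF cv cv, of X]
        inprod_continuous[OF continuous_on_mult[OF cont(6) cont(3)] cont(3), of X] integral_Q_h2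
      by simp
    show "inprod X ?v w' - inprod X (\<lambda>x. r (h x) * h2 x) w \<noteq> 0" using grad ne by simp
  qed
  then show ?thesis using energy_unstable_of_negative_direction by blast
qed

lemma energy_unstable_of_linearly_unstable:
  assumes "linearly_unstable r X h"
  shows "energy_unstable H X h"
proof -
  define A where "A = {u \<in> H1_mean_zero X. \<not> (AE x in lebesgue. u x = 0)}"
  define R where "R = (\<lambda>u. (LINT x:{0..X}|lebesgue. (weak_deriv X u x)\<^sup>2 - r (h x) * (u x)\<^sup>2) /
        (LINT x:{0..X}|lebesgue. (u x)\<^sup>2))"
  have "(INF u\<in>A. R u) < 0"
    using assms by (simp add: linearly_unstable_def \<tau>\<^sub>1_def A_def R_def)
  \<comment> \<open>Over an empty set a negative infimum would say nothing about individual
    quotients. The sine of period \<open>X\<close> shows that there are admissible functions, and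
    then some quotient must itself be negative.\<close>
  moreover have "A \<noteq> {}"
  proof -
    define a where "a = 2 * pi / X"
    have aX: "a * X = 2 * pi" and a: "0 < a" using X by (simp_all add: a_def)
    let ?s = "\<lambda>x. sin (a * x)"
    have ps: "periodic_fun_simple ?s X" by (intro periodic_funI) (simp add: distrib_left aX)
    have "integral {0..X} ?s = 0"
    proof (rule integral_unique, rule FTC_periodic)
      show "((\<lambda>x. - cos (a * x) / a) has_real_derivative ?s x) (at x)" for x
        using a by (auto intro!: derivative_eq_intros)
    qed (use X aX in \<open>auto intro: periodic_funI simp: distrib_left\<close>)
    then have "?s \<in> H1_mean_zero X"
      by (intro H1_mean_zeroI[where u' = "\<lambda>x. a * cos (a * x)"] ps)
         (auto intro!: derivative_eq_intros continuous_intros)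
    moreover have "\<not> (AE x in lebesgue. ?s x = 0)"
    proof
      assume "AE x in lebesgue. ?s x = 0"
      moreover have op: "open {x. ?s x \<noteq> 0}"
        by (intro open_Collect_neq continuous_intros)
      moreover have "{x. ?s x \<noteq> 0} \<in> sets lebesgue" using op by (simp add: borel_open)
      ultimately have "negligible {x. ?s x \<noteq> 0}"
        using AE_iff_null_sets[of "{x. ?s x \<noteq> 0}" lebesgue]
        by (simp add: negligible_iff_null_sets)
      moreover have "sin (a * (pi / 2 / a)) \<noteq> 0" using a by simp
      then have "{x. ?s x \<noteq> 0} \<noteq> {}" by blast
      ultimately show False using open_not_negligible op by blast
    qed
    ultimately show ?thesis by (auto simp: A_def)
  qed
  ultimately obtain u where u: "u \<in> A" "R u < 0"
    using cINF_greatest[of A 0 R] by (metis linorder_not_le)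
  have h1u: "u \<in> H1 X" and mu: "(LINT x:{0..X}|lebesgue. u x) = 0"
    using u(1) by (auto simp: A_def H1_mean_zero_def)
  let ?v = "weak_deriv X u"
  have su: "square_integrable X u" using h1u by (auto simp: H1_def L2_square_integrable)
  have sv: "square_integrable X ?v" using H1_weak_deriv(1)[OF h1u] by (rule L2_square_integrable)
  have sr: "square_integrable X (\<lambda>x. r (h x) * u x)"
    by (rule square_integrable_continuous_mult[OF cont(6) su])
  have "0 \<le> (LINT x:{0..X}|lebesgue. (u x)\<^sup>2)" by (simp add: set_lebesgue_integral_lebesgue_on)
  then have "(LINT x:{0..X}|lebesgue. (?v x)\<^sup>2 - r (h x) * (u x)\<^sup>2) < 0"
    using u(2) unfolding R_def by (simp add: divide_less_0_iff)
  moreover have "(LINT x:{0..X}|lebesgue. (?v x)\<^sup>2 - r (h x) * (u x)\<^sup>2) =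
      inprod X ?v ?v - inprod X (\<lambda>x. r (h x) * u x) u"
    unfolding set_lebesgue_integral_lebesgue_on inprod_def
    using square_integrable_mult[OF sv sv] square_integrable_mult[OF sr su]
    by (subst Bochner_Integration.integral_diff[symmetric]) (auto simp: power2_eq_square mult.assoc)
  ultimately have "\<exists>\<phi>. negative_direction X (\<lambda>x. r (h x)) \<phi>"
    using mu by (intro smooth_negative_direction[OF X cont(6) su sv H1_weak_deriv(2)[OF h1u]])
      (auto simp: set_lebesgue_integral_lebesgue_on inprod_def)
  then show ?thesis using energy_unstable_of_negative_direction by blast
qed

end

subsection \<open>Several periods\<close>

text \<open>This allows the left end of a nodal interval to be placed at 0, so that both cut-off
  pieces lie inside the integration interval.\<close>

lemma negative_direction_shift:
  assumes "0 < X" "continuous_on UNIV q" "periodic_fun_simple q X"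
    and "negative_direction X (\<lambda>x. q (x + a)) \<phi>"
  shows "negative_direction X q (\<lambda>x. \<phi> (x - a))"
proof -
  have \<phi>: "smooth \<phi>" "periodic_fun_simple \<phi> X" "integral {0..X} \<phi> = 0"
      "integral {0..X} (\<lambda>x. (deriv \<phi> x)\<^sup>2 - q (x + a) * (\<phi> x)\<^sup>2) < 0"
    using assms(4) by (auto simp: negative_direction_def)
  have p: "periodic_fun_simple (deriv \<phi>) X"
    by (rule periodic_deriv[OF \<phi>(2) smooth_has_deriv[OF \<phi>(1)]])
  have "((\<lambda>x. \<phi> (x + - a)) has_real_derivative deriv \<phi> (x + - a)) (at x)" for x
    by (rule DERIV_shift[THEN iffD1]) (rule smooth_has_deriv[OF \<phi>(1)])
  then have d: "deriv (\<lambda>x. \<phi> (x - a)) = (\<lambda>x. deriv \<phi> (x + - a))"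
    by (auto intro: DERIV_imp_deriv)
  have 1: "integral {0..X} (\<lambda>x. \<phi> (x + - a)) = integral {0..X} \<phi>"
    using assms(1) \<phi> by (intro integral_periodic_shift smooth_continuous) auto
  have 2: "integral {0..X} (\<lambda>x. (\<lambda>x. (deriv \<phi> x)\<^sup>2 - q (x + a) * (\<phi> x)\<^sup>2) (x + - a)) =
      integral {0..X} (\<lambda>x. (deriv \<phi> x)\<^sup>2 - q (x + a) * (\<phi> x)\<^sup>2)"
  proof (rule integral_periodic_shift)
    show "continuous_on UNIV (\<lambda>x. (deriv \<phi> x)\<^sup>2 - q (x + a) * (\<phi> x)\<^sup>2)"
      by (intro continuous_intros continuous_on_compose2[OF assms(2)] smooth_continuous smooth_deriv \<phi>)
         auto
    have "q (x + X + a) = q (x + a)" for x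
      using periodic_funD[OF assms(3), of "x + a"] by (simp add: add_ac)
    then show "periodic_fun_simple (\<lambda>x. (deriv \<phi> x)\<^sup>2 - q (x + a) * (\<phi> x)\<^sup>2) X"
      using periodic_funD[OF p] periodic_funD[OF \<phi>(2)] by (intro periodic_funI) simp
  qed (use assms(1) in simp)
  show ?thesis
    unfolding negative_direction_def
  proof (intro conjI)
    show "smooth (\<lambda>x. \<phi> (x - a))" using smooth_shift[OF \<phi>(1), of "- a"] by simp
    have "\<phi> (x + X - a) = \<phi> (x - a)" for x
      using periodic_funD[OF \<phi>(2), of "x - a"] by (simp add: algebra_simps)
    then show "periodic_fun_simple (\<lambda>x. \<phi> (x - a)) X" by (rule periodic_funI)
    show "integral {0..X} (\<lambda>x. \<phi> (x - a)) = 0" using 1 \<phi>(3) by simp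
    show "integral {0..X} (\<lambda>x. (deriv (\<lambda>x. \<phi> (x - a)) x)\<^sup>2 - q x * (\<phi> (x - a))\<^sup>2) < 0"
      using 2 \<phi>(4) unfolding d by simp
  qed
qed

text \<open>This is Gronwall's argument: \<open>k^2 + k1^2\<close> grows at most at the rate
  \<open>1 + B\<close>, because its derivative is \<open>2 * (1 - q) * k * k1\<close>. The
  exponential weight makes it nonincreasing, and it starts at 0.\<close>

lemma second_order_ode_zero:
  fixes k :: "real \<Rightarrow> real"
  assumes "\<And>x. (k has_real_derivative k1 x) (at x)" "\<And>x. (k1 has_real_derivative - (q x * k x)) (at x)"
    and "\<And>x. \<bar>q x\<bar> \<le> B" "k a = 0" "k1 a = 0" "a \<le> x"
  shows "k x = 0"
proof -
  define y where "y = (\<lambda>x. ((k x)\<^sup>2 + (k1 x)\<^sup>2) * exp (- (1 + B) * x))"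
  have "y x \<le> y a"
  proof (rule DERIV_nonpos_imp_nonincreasing[OF assms(6)])
    fix x
    have "(y has_real_derivative
        (2 * (1 - q x) * (k x * k1 x) - (1 + B) * ((k x)\<^sup>2 + (k1 x)\<^sup>2)) * exp (- (1 + B) * x)) (at x)"
      unfolding y_def using assms(1)[of x] assms(2)[of x]
      by (auto intro!: derivative_eq_intros simp: algebra_simps)
    moreover have "2 * (1 - q x) * (k x * k1 x) \<le> (1 + B) * ((k x)\<^sup>2 + (k1 x)\<^sup>2)"
    proof -
      have "2 * (1 - q x) * (k x * k1 x) = 2 * ((1 - q x) * (k x * k1 x))" by (simp only: mult.assoc)
      also have "\<dots> \<le> 2 * \<bar>(1 - q x) * (k x * k1 x)\<bar>" by simp
      also have "\<dots> = \<bar>1 - q x\<bar> * (2 * \<bar>k x\<bar> * \<bar>k1 x\<bar>)" by (simp add: abs_mult)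
      also have "\<dots> \<le> (1 + B) * ((k x)\<^sup>2 + (k1 x)\<^sup>2)"
        using assms(3)[of x] sum_squares_bound[of "\<bar>k x\<bar>" "\<bar>k1 x\<bar>"]
        by (intro mult_mono) auto
      finally show ?thesis .
    qed
    ultimately show "\<exists>z. (y has_real_derivative z) (at x) \<and> z \<le> 0"
      by (intro exI conjI) (auto simp: mult_nonpos_nonneg)
  qed
  then have "(k x)\<^sup>2 + (k1 x)\<^sup>2 \<le> 0"
    using assms(4,5) by (simp add: y_def mult_le_0_iff not_le[symmetric])
  then show ?thesis by (simp add: sum_power2_le_zero_iff)
qed

lemma square_integrable_indicator:
  assumes "square_integrable X f" "A \<in> sets borel"
  shows "square_integrable X (\<lambda>x. indicator A x * f x)"
proof -
  have [measurable]: "f \<in> borel_measurable (lebesgue_on {0..X})"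
    using assms(1) by (simp add: square_integrable_def)
  have [measurable]: "A \<inter> {0..X} \<in> sets (lebesgue_on {0..X})"
    using assms(2) by (subst sets_restrict_space_iff) (auto intro: sets.Int)
  have m: "(\<lambda>x. indicator (A \<inter> {0..X}) x * f x) \<in> borel_measurable (lebesgue_on {0..X})"
    by measurable
  have m': "(\<lambda>x. indicator A x * f x) \<in> borel_measurable (lebesgue_on {0..X})"
    by (rule measurable_cong[THEN iffD1, OF _ m]) (simp add: space_restrict_space indicator_def)
  have "integrable (lebesgue_on {0..X}) (\<lambda>x. (indicator A x * f x)\<^sup>2)"
  proof (rule Bochner_Integration.integrable_bound)
    show "integrable (lebesgue_on {0..X}) (\<lambda>x. (f x)\<^sup>2)" using assms by (simp add: square_integrable_def)
    show "(\<lambda>x. (indicator A x * f x)\<^sup>2) \<in> borel_measurable (lebesgue_on {0..X})"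
      using m' by measurable
  qed (auto simp: indicator_def)
  with m' show ?thesis by (simp add: square_integrable_def)
qed

lemma integral_indicator_open:
  fixes f :: "real \<Rightarrow> real"
  assumes "0 \<le> c" "c \<le> d" "d \<le> X" "continuous_on UNIV f" "\<And>x. (F has_real_derivative f x) (at x)"
  shows "integrable (lebesgue_on {0..X}) (\<lambda>x. indicator {c<..<d} x * f x)"
    and "integral\<^sup>L (lebesgue_on {0..X}) (\<lambda>x. indicator {c<..<d} x * f x) = F d - F c"
proof -
  have "square_integrable X (\<lambda>x. indicator {c<..<d} x * f x)"
    using continuous_on_subset[OF assms(4)]
    by (intro square_integrable_indicator square_integrable_continuous) auto
  then show i: "integrable (lebesgue_on {0..X}) (\<lambda>x. indicator {c<..<d} x * f x)"
    by (rule square_integrable_integrable)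
  have "(f has_integral F d - F c) {c..d}" using FTC_has_integral[OF assms(2,5)] .
  then have "((\<lambda>x. if x \<in> {c..d} then f x else 0) has_integral F d - F c) {0..X}"
    using assms(1,3) by (subst has_integral_restrict) auto
  then have "((\<lambda>x. indicator {c<..<d} x * f x) has_integral F d - F c) {0..X}"
    by (rule has_integral_spike_finite[where S = "{c, d}", rotated 2]) (auto simp: indicator_def)
  then show "integral\<^sup>L (lebesgue_on {0..X}) (\<lambda>x. indicator {c<..<d} x * f x) = F d - F c"
    using i by (subst lebesgue_integral_eq_integral) (auto intro: integral_unique)
qed

text \<open>
  With \<open>k\<close> vanishing at the ends of the nodal interval \<open>(0, b)\<close>, the function equal to \<open>k\<close> there, to
  \<open>-k\<close> on the next translate and to zero elsewhere has mean zero and makes the form vanish. The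
  corner at \<open>0\<close> prevents it from being critical.
\<close>

lemma negative_direction_nodal:
  fixes q K k k1 :: "real \<Rightarrow> real" and j :: nat
  assumes P: "0 < P" "2 \<le> j" and q: "continuous_on UNIV q"
    and d: "\<And>x. (K has_real_derivative k x) (at x)" "\<And>x. (k has_real_derivative k1 x) (at x)"
      "\<And>x. (k1 has_real_derivative - (q x * k x)) (at x)"
    and per: "periodic_fun_simple K P"
    and b: "0 < b" "b < P" "k 0 = 0" "k b = 0" "k1 0 \<noteq> 0"
  shows "\<exists>\<phi>. negative_direction (real j * P) q \<phi>"
proof -
  define X where "X = real j * P"
  have "2 * P \<le> X" using P by (simp add: X_def)
  then have X: "0 < X" "P + b < X" using P b by linarith+
  have perk: "periodic_fun_simple k P" "periodic_fun_simple k1 P"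
    using periodic_deriv[OF per d(1)] periodic_deriv[OF periodic_deriv[OF per d(1)] d(2)] .
  have shift: "K (P + x) = K x" "k (P + x) = k x" "k1 (P + x) = k1 x" for x
    using periodic_funD[OF per, of x] periodic_funD[OF perk(1), of x] periodic_funD[OF perk(2), of x]
    by (simp_all add: add.commute)
  have shift0: "K P = K 0" "k P = k 0" "k1 P = k1 0" using shift[of 0] by simp_all
  have ck: "continuous_on S k" and ck1: "continuous_on S k1" for S
    using d by (meson DERIV_isCont continuous_at_imp_continuous_on)+
  have cq: "continuous_on S q" for S using q continuous_on_subset by blast
  define s where "s = (\<lambda>x. indicator {0<..<b} x - indicator {P<..<P + b} x :: real)"
  have s2: "s x * s x = indicator {0<..<b} x + indicator {P<..<P + b} x" for x
    using b by (auto simp: s_def indicator_def)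
  have int_s: "integral\<^sup>L (lebesgue_on {0..X}) (\<lambda>x. s x * f x) = F b - F 0 - (F (P + b) - F P)"
    and int_s2: "integral\<^sup>L (lebesgue_on {0..X}) (\<lambda>x. s x * s x * f x) = F b - F 0 + (F (P + b) - F P)"
    if "continuous_on UNIV f" "\<And>x. (F has_real_derivative f x) (at x)" for f F
  proof -
    have "0 \<le> b" "b \<le> X" "0 \<le> P" "P \<le> P + b" "P + b \<le> X" using b X P by linarith+
    note i = integral_indicator_open[OF order_refl this(1,2) that]
      integral_indicator_open[OF this(3-5) that]
    show "integral\<^sup>L (lebesgue_on {0..X}) (\<lambda>x. s x * f x) = F b - F 0 - (F (P + b) - F P)"
      using i by (simp add: s_def left_diff_distrib)
    show "integral\<^sup>L (lebesgue_on {0..X}) (\<lambda>x. s x * s x * f x) = F b - F 0 + (F (P + b) - F P)"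
      unfolding s2 using i by (simp add: distrib_right)
  qed
  have sq_s: "square_integrable X (\<lambda>x. s x * f x)" if "continuous_on {0..X} f" for f
    unfolding s_def left_diff_distrib using that
    by (intro square_integrable_diff square_integrable_indicator square_integrable_continuous) auto
  define u where "u = (\<lambda>x. s x * k x)"
  define v where "v = (\<lambda>x. s x * k1 x)"
  have su: "square_integrable X u" and sv: "square_integrable X v"
    unfolding u_def v_def by (intro sq_s ck ck1)+
  \<comment> \<open>This form makes continuity evident: outside its interval each clamped term
    equals \<open>k\<close> at an endpoint, which is 0.\<close>
  have u_clamp: "u x = k (max 0 (min b x)) - k (max P (min (P + b) x))" for x
  proof -
    consider "x \<le> 0" | "0 < x" "x < b" | "b \<le> x" "x \<le> P" | "P < x" "x < P + b" | "P + b \<le> x" by linarith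
    then show ?thesis
      using b shift shift0 by cases (auto simp: u_def s_def indicator_def max_def min_def)
  qed
  \<comment> \<open>The frequency gives the cosine the period \<open>X\<close>. Two periods fit into
    \<open>X\<close>, so \<open>\<theta> * P\<close> is at most \<open>pi\<close>; this is where
    \<open>2 \<le> j\<close> enters.\<close>
  define \<theta> where "\<theta> = 2 * pi / X"
  have \<theta>: "0 < \<theta>" "\<theta> * X = 2 * pi" "\<theta> * P \<le> pi"
  proof -
    show "0 < \<theta>" "\<theta> * X = 2 * pi" using X by (simp_all add: \<theta>_def)
    then have "\<theta> * (2 * P) \<le> 2 * pi" using mult_left_mono[OF \<open>2 * P \<le> X\<close>, of \<theta>] by simp
    then show "\<theta> * P \<le> pi" by simp
  qed
  \<comment> \<open>The cosine is centred at the midpoint of \<open>b\<close> and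
    \<open>P + b\<close>. It takes equal values there, so the boundary terms with
    \<open>k1 b\<close> cancel in the pairing of \<open>u\<close> and \<open>w\<close>, which
    becomes \<open>k1 0 * (w P - w 0)\<close>.\<close>
  define w where "w = (\<lambda>x. cos (\<theta> * (x - b - P / 2)))"
  define w' where "w' = (\<lambda>x. - \<theta> * sin (\<theta> * (x - b - P / 2)))"
  have dw: "(w has_real_derivative w' x) (at x)" for x
    unfolding w_def w'_def by (auto intro!: derivative_eq_intros)
  have cw: "continuous_on S w" and cw': "continuous_on S w'" for S
    unfolding w_def w'_def by (intro continuous_intros)+
  have arg: "\<theta> * (x + X - b - P / 2) = \<theta> * (x - b - P / 2) + 2 * pi" for x
    unfolding \<theta>(2)[symmetric] by (simp add: algebra_simps)
  have pw: "periodic_fun_simple w X"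
    by (intro periodic_funI) (simp only: w_def arg cos_periodic)
  have iw: "integral {0..X} w = 0"
  proof (rule integral_unique, rule FTC_periodic)
    show "((\<lambda>x. sin (\<theta> * (x - b - P / 2)) / \<theta>) has_real_derivative w x) (at x)" for x
      unfolding w_def using \<theta>(1) by (auto intro!: derivative_eq_intros)
    show "periodic_fun_simple (\<lambda>x. sin (\<theta> * (x - b - P / 2)) / \<theta>) X"
      by (intro periodic_funI) (simp only: arg sin_periodic)
  qed (use X in simp)
  have "\<exists>\<phi>. negative_direction X q \<phi>"
  proof (rule negative_direction_of_noncritical[OF X(1) cq su sv _ _ _ dw cw' pw iw])
    show "is_weak_deriv X u v"
    proof (rule is_weak_deriv_piecewise[where S = "{0, b, P, P + b}"])
      show "continuous_on {0..X} u"
        unfolding u_clamp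
        by (intro continuous_intros continuous_on_compose2[OF ck[of UNIV]]) auto
      show "u 0 = u X" using X b by (simp add: u_def s_def indicator_def)
      fix x assume "x \<in> {0<..<X} - {0, b, P, P + b}"
      then consider "0 < x" "x < b" | "b < x" "x < P" | "P < x" "x < P + b" | "P + b < x" by force
      then show "(u has_real_derivative v x) (at x)"
      proof cases
        case 1
        have "(u has_real_derivative k1 x) (at x)"
          by (rule has_field_derivative_transform_within_open[OF d(2), where S = "{0<..<b}"])
             (use 1 b in \<open>auto simp: u_def s_def indicator_def\<close>)
        then show ?thesis using 1 b by (simp add: v_def s_def indicator_def)
      next
        case 2
        have "(u has_real_derivative 0) (at x)"
          by (rule has_field_derivative_transform_within_open[where S = "{b<..<P}" and f = "\<lambda>_. 0"])
             (rule DERIV_const, use 2 in \<open>auto simp: u_def s_def indicator_def\<close>)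
        then show ?thesis using 2 by (simp add: v_def s_def indicator_def)
      next
        case 3
        have "(u has_real_derivative - k1 x) (at x)"
          by (rule has_field_derivative_transform_within_open[OF DERIV_minus[OF d(2)], where S = "{P<..<P + b}"])
             (use 3 b in \<open>auto simp: u_def s_def indicator_def\<close>)
        then show ?thesis using 3 b by (simp add: v_def s_def indicator_def)
      next
        case 4
        have "(u has_real_derivative 0) (at x)"
          by (rule has_field_derivative_transform_within_open[where S = "{P + b<..}" and f = "\<lambda>_. 0"])
             (rule DERIV_const, use 4 P b in \<open>auto simp: u_def s_def indicator_def\<close>)
        then show ?thesis using 4 P b by (simp add: v_def s_def indicator_def)
      qed
    qed (use X sv in auto)
    \<comment> \<open>The pieces contribute \<open>K b - K 0\<close> with opposite signs, by
      periodicity of \<open>K\<close>.\<close>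
    show "inprod X u (\<lambda>_. 1) = 0"
      unfolding inprod_def u_def using int_s[OF ck d(1)] by (simp add: shift shift0)
    \<comment> \<open>By the equation for \<open>k1\<close>, the integrand of the form is exact on
      each piece, with an antiderivative that vanishes at both nodes.\<close>
    have "((\<lambda>x. k x * k1 x) has_real_derivative k1 x * k1 x - q x * k x * k x) (at x)" for x
      using d(2)[of x] d(3)[of x] by (auto intro!: derivative_eq_intros)
    then have "integral\<^sup>L (lebesgue_on {0..X}) (\<lambda>x. s x * s x * (k1 x * k1 x - q x * k x * k x)) = 0"
      using int_s2[of "\<lambda>x. k1 x * k1 x - q x * k x * k x" "\<lambda>x. k x * k1 x"] b
      by (simp add: shift shift0 continuous_intros ck ck1 cq)
    moreover have "inprod X v v - inprod X (\<lambda>x. q x * u x) u =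
        integral\<^sup>L (lebesgue_on {0..X}) (\<lambda>x. s x * s x * (k1 x * k1 x - q x * k x * k x))"
      unfolding inprod_def
      using square_integrable_mult[OF sv sv]
        square_integrable_mult[OF square_integrable_continuous_mult[OF cq su] su]
      by (subst Bochner_Integration.integral_diff[symmetric])
         (auto simp: u_def v_def algebra_simps intro!: Bochner_Integration.integral_cong)
    ultimately show "inprod X v v - inprod X (\<lambda>x. q x * u x) u \<le> 0" by simp
    have "((\<lambda>x. k1 x * w x) has_real_derivative k1 x * w' x - q x * k x * w x) (at x)" for x
      using d(3)[of x] dw[of x] by (auto intro!: derivative_eq_intros)
    then have "integral\<^sup>L (lebesgue_on {0..X}) (\<lambda>x. s x * (k1 x * w' x - q x * k x * w x)) =
        k1 b * w b - k1 0 * w 0 - (k1 b * w (P + b) - k1 0 * w P)"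
      using int_s[of "\<lambda>x. k1 x * w' x - q x * k x * w x" "\<lambda>x. k1 x * w x"]
      by (simp add: shift shift0 continuous_intros ck ck1 cq cw cw')
    moreover have "inprod X v w' - inprod X (\<lambda>x. q x * u x) w =
        integral\<^sup>L (lebesgue_on {0..X}) (\<lambda>x. s x * (k1 x * w' x - q x * k x * w x))"
      unfolding inprod_def
      using square_integrable_mult[OF sv square_integrable_continuous[OF cw']]
        square_integrable_mult[OF square_integrable_continuous_mult[OF cq su] square_integrable_continuous[OF cw]]
      by (subst Bochner_Integration.integral_diff[symmetric])
         (auto simp: u_def v_def algebra_simps intro!: Bochner_Integration.integral_cong)
    moreover have "w b = w (P + b)"
      using cos_minus[of "\<theta> * (P / 2)"] by (simp add: w_def)
    \<comment> \<open>Both sines are positive: \<open>\<theta> * b\<close> is below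
      \<open>\<theta> * P\<close>, hence below \<open>pi\<close>, and
      \<open>\<theta> * (P / 2)\<close> is at most half of \<open>pi\<close>.\<close>
    moreover have "w P - w 0 = 2 * sin (\<theta> * b) * sin (\<theta> * (P / 2))"
    proof -
      have "w P = cos (\<theta> * b - \<theta> * (P / 2))"
        using cos_minus[of "\<theta> * b - \<theta> * (P / 2)"] by (simp add: w_def algebra_simps)
      moreover have "w 0 = cos (\<theta> * b + \<theta> * (P / 2))"
        using cos_minus[of "\<theta> * b + \<theta> * (P / 2)"] by (simp add: w_def algebra_simps)
      ultimately show ?thesis by (simp add: cos_add cos_diff)
    qed
    moreover have "0 < sin (\<theta> * b)"
    proof (rule sin_gt_zero)
      have "\<theta> * b < \<theta> * P" using b(2) \<theta>(1) by simp
      then show "\<theta> * b < pi" using \<theta>(3) by linarith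
    qed (use \<theta> b in simp)
    moreover have "0 < sin (\<theta> * (P / 2))"
    proof (rule sin_gt_zero)
      show "\<theta> * (P / 2) < pi" using \<theta>(3) pi_gt_zero unfolding times_divide_eq_right by linarith
    qed (use \<theta> P in simp)
    ultimately have "inprod X v w' - inprod X (\<lambda>x. q x * u x) w =
        k1 0 * (2 * sin (\<theta> * b) * sin (\<theta> * (P / 2)))" "0 < sin (\<theta> * b)" "0 < sin (\<theta> * (P / 2))"
      by (simp_all add: right_diff_distrib[symmetric])
    then show "inprod X v w' - inprod X (\<lambda>x. q x * u x) w \<noteq> 0" using b(5) by simp
  qed
  then show ?thesis by (simp add: X_def)
qed

text \<open>Take the last node \<open>a\<close> before \<open>x0\<close> and the first node
  \<open>b\<close> after it; Rolle's theorem for \<open>K\<close> provides nodes on both sides. The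
  slope at \<open>a\<close> is nonzero, since otherwise uniqueness for the equation would force
  \<open>k x0 = 0\<close>. Translating \<open>a\<close> to 0 leads to
  \<open>negative_direction_nodal\<close>.\<close>

lemma negative_direction_several_periods:
  fixes q K k k1 :: "real \<Rightarrow> real" and j :: nat
  assumes P: "0 < P" "2 \<le> j" and q: "continuous_on UNIV q" "periodic_fun_simple q P"
    and d: "\<And>x. (K has_real_derivative k x) (at x)" "\<And>x. (k has_real_derivative k1 x) (at x)"
      "\<And>x. (k1 has_real_derivative - (q x * k x)) (at x)"
    and per: "periodic_fun_simple K P"
    and x0: "k x0 \<noteq> 0"
  shows "\<exists>\<phi>. negative_direction (real j * P) q \<phi>"
proof -
  have ck: "continuous_on S k" for S
    using d(2) by (meson DERIV_isCont continuous_at_imp_continuous_on)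
  have cz: "compact {x \<in> {c..e}. k x = 0}" for c e
    using continuous_closed_preimage_constant[OF ck, of "{c..e}" 0]
    by (auto simp: compact_eq_bounded_closed intro: bounded_subset[OF bounded_closed_interval[of c e]])
  have kper: "periodic_fun_simple k P" by (rule periodic_deriv[OF per d(1)])
  obtain z1 where z1: "x0 - P < z1" "z1 < x0" "k z1 = 0"
    using Rolle_periodic[OF P(1) per d(1), of "x0 - P"] by auto
  obtain z2 where z2: "x0 < z2" "z2 < x0 + P" "k z2 = 0"
    using Rolle_periodic[OF P(1) per d(1), of x0] by auto
  have "{x \<in> {x0 - P..x0}. k x = 0} \<noteq> {}" using z1 by force
  then obtain a where a: "a \<in> {x0 - P..x0}" "k a = 0"
      "\<And>x. x \<in> {x0 - P..x0} \<Longrightarrow> k x = 0 \<Longrightarrow> x \<le> a"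
    using compact_attains_sup[OF cz, of "x0 - P" x0] by auto
  have "{x \<in> {x0..x0 + P}. k x = 0} \<noteq> {}" using z2 by force
  then obtain b where b: "b \<in> {x0..x0 + P}" "k b = 0"
      "\<And>x. x \<in> {x0..x0 + P} \<Longrightarrow> k x = 0 \<Longrightarrow> b \<le> x"
    using compact_attains_inf[OF cz, of x0 "x0 + P"] by auto
  have ab: "a < x0" "x0 < b" using a(1,2) b(1,2) x0 by (auto simp: less_le)
  \<comment> \<open>Rolle's theorem gives a node strictly between \<open>a\<close> and
    \<open>a + P\<close>. By maximality of \<open>a\<close> it lies beyond \<open>x0\<close>, hence
    at or beyond \<open>b\<close>. The strict inequality keeps the two cut-off pieces
    disjoint.\<close>
  have "b < a + P"
  proof -
    obtain z where z: "a < z" "z < a + P" "k z = 0" using Rolle_periodic[OF P(1) per d(1)] .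
    have "\<not> z \<le> x0" using a(1) a(3)[of z] z by auto
    then have "b \<le> z" using b(3)[of z] z a(1) by auto
    with z show ?thesis by simp
  qed
  obtain B where B: "\<And>x. \<bar>q x\<bar> \<le> B" using periodic_bounded[OF P(1) q] by blast
  have k1a: "k1 a \<noteq> 0"
    using second_order_ode_zero[OF d(2,3) B a(2), of x0] ab(1) x0 by auto
  have "\<exists>\<phi>. negative_direction (real j * P) (\<lambda>x. q (x + a)) \<phi>"
  proof (rule negative_direction_nodal[OF P])
    show "continuous_on UNIV (\<lambda>x. q (x + a))"
      by (intro continuous_on_compose2[OF q(1)] continuous_intros) auto
    show "((\<lambda>x. K (x + a)) has_real_derivative k (x + a)) (at x)"
      "((\<lambda>x. k (x + a)) has_real_derivative k1 (x + a)) (at x)"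
      "((\<lambda>x. k1 (x + a)) has_real_derivative - (q (x + a) * k (x + a))) (at x)" for x
      by (rule DERIV_shift[THEN iffD1], rule d)+
    show "periodic_fun_simple (\<lambda>x. K (x + a)) P"
      using periodic_funD[OF per, of "x + a" for x] by (intro periodic_funI) (simp add: add_ac)
    show "0 < b - a" "b - a < P" "k (0 + a) = 0" "k (b - a + a) = 0" "k1 (0 + a) \<noteq> 0"
      using ab \<open>b < a + P\<close> a b k1a by auto
  qed
  then obtain \<phi> where "negative_direction (real j * P) (\<lambda>x. q (x + a)) \<phi>" by blast
  moreover have "periodic_fun_simple q (real j * P)"
  proof -
    interpret q: periodic_fun_simple q P by (rule q(2))
    show ?thesis by (intro periodic_funI q.plus_of_nat)
  qed
  moreover have "0 < real j * P" using P by simp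
  ultimately show ?thesis using negative_direction_shift[OF _ q(1)] by blast
qed

subsection \<open>Regularity of the coefficients\<close>

lemma Ck_on_2_has_derivatives:
  assumes "Ck_on 2 S f" "x \<in> S"
  shows "(f has_real_derivative deriv f x) (at x)"
    and "(deriv f has_real_derivative deriv (deriv f) x) (at x)"
    and "continuous_on S (deriv (deriv f))"
  using assms by (auto simp: Ck_on_Suc numeral_2_eq_2 Ck_on_0 DERIV_deriv_iff_real_differentiable)

text \<open>The quotient rule identifies \<open>deriv r\<close> with \<open>r1\<close> on the
  positive half-line only; openness of that set allows differentiating the identity once
  more.\<close>

lemma quotient_derivatives:
  fixes f g :: "real \<Rightarrow> real"
  assumes "Ck_on 2 {0<..} f" "Ck_on 2 {0<..} g" "\<forall>y>0. 0 < f y" "r = (\<lambda>y. g y / f y)"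
  shows "\<And>y. 0 < y \<Longrightarrow> (r has_real_derivative deriv r y) (at y)"
    and "\<And>y. 0 < y \<Longrightarrow> (deriv r has_real_derivative (deriv ^^ 2) r y) (at y)"
    and "continuous_on {0<..} ((deriv ^^ 2) r)"
proof -
  define r1 where "r1 = (\<lambda>y. (deriv g y * f y - g y * deriv f y) / (f y * f y))"
  define r2 where "r2 = (\<lambda>y. ((deriv (deriv g) y * f y - g y * deriv (deriv f) y) * (f y * f y) -
    (deriv g y * f y - g y * deriv f y) * (2 * f y * deriv f y)) / ((f y * f y) * (f y * f y)))"
  note df = Ck_on_2_has_derivatives[OF assms(1)] and dg = Ck_on_2_has_derivatives[OF assms(2)]
  have f0: "f y \<noteq> 0" if "0 < y" for y using assms(3) that by force
  have 1: "(r has_real_derivative r1 y) (at y)" if "0 < y" for y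
    unfolding assms(4) r1_def using df(1)[of y] dg(1)[of y] f0[OF that] that
    by (auto intro!: derivative_eq_intros)
  have 2: "(r1 has_real_derivative r2 y) (at y)" if "0 < y" for y
    unfolding r1_def r2_def using df(1,2)[of y] dg(1,2)[of y] f0[OF that] that
    by (auto intro!: derivative_eq_intros simp: algebra_simps)
  have c: "continuous_on {0<..} f" "continuous_on {0<..} g" "continuous_on {0<..} (deriv f)"
    "continuous_on {0<..} (deriv g)"
    using df dg by (meson DERIV_isCont continuous_at_imp_continuous_on)+
  have c2: "continuous_on {0<..} r2"
    unfolding r2_def using df(3)[of 1] dg(3)[of 1] f0
    by (intro continuous_intros c) auto
  have e1: "deriv r y = r1 y" if "0 < y" for y using 1[OF that] by (rule DERIV_imp_deriv)
  have 3: "(deriv r has_real_derivative r2 y) (at y)" if "0 < y" for y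
    by (rule has_field_derivative_transform_within_open[OF 2[OF that], of "{0<..}"])
       (use that e1 in auto)
  have e2: "(deriv ^^ 2) r y = r2 y" if "0 < y" for y
    using DERIV_imp_deriv[OF 3[OF that]] by (simp add: numeral_2_eq_2)
  show "(r has_real_derivative deriv r y) (at y)" if "0 < y" for y
    using 1[OF that] e1[OF that] by simp
  show "(deriv r has_real_derivative (deriv ^^ 2) r y) (at y)" if "0 < y" for y
    using 3[OF that] e2[OF that] by simp
  show "continuous_on {0<..} ((deriv ^^ 2) r)"
    by (rule continuous_on_cong[THEN iffD2, OF refl e2 c2]) simp
qed

lemma convex_on_second_derivative_nonneg:
  assumes "convex_on {0<..} r" "\<And>y. 0 < y \<Longrightarrow> (r has_real_derivative r1 y) (at y)"
    and "\<And>y. 0 < y \<Longrightarrow> (r1 has_real_derivative r2 y) (at y)" "0 < y"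
  shows "0 \<le> r2 y"
proof (rule mono_on_imp_deriv_nonneg[OF _ assms(3)[OF assms(4)]])
  have tangent: "r1 c * (x - c) \<le> r x - r c" if "0 < c" "0 < x" for c x
    using that by (intro convex_on_imp_above_tangent[OF assms(1)])
      (auto intro: has_field_derivative_at_within assms(2) simp: interior_open)
  show "mono_on {0<..} r1"
  proof (rule mono_onI)
    fix x y :: real assume xy: "x \<in> {0<..}" "y \<in> {0<..}" "x \<le> y"
    show "r1 x \<le> r1 y"
    proof (cases "x = y")
      case False
      \<comment> \<open>Add the tangent inequality at \<open>x\<close>, evaluated at
        \<open>y\<close>, to the one at \<open>y\<close>, evaluated at \<open>x\<close>.\<close>
      have "r1 x * (y - x) \<le> r1 y * (y - x)"
        using tangent[of x y] tangent[of y x] xy by (simp add: algebra_simps)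
      then show ?thesis using False xy by (simp add: mult_le_cancel_right)
    qed simp
  qed
qed (use assms(4) in \<open>simp add: interior_open\<close>)

text \<open>The flux is a constant \<open>c\<close>, so \<open>h'' + H'(h)\<close> has derivative
  \<open>c / f(h)\<close>. This sum is periodic, so its derivative vanishes somewhere, which forces
  \<open>c = 0\<close>.\<close>

lemma positive_steady_state_locale:
  fixes f g r H h :: "real \<Rightarrow> real"
  assumes f: "Ck_on 2 {0<..} f" and g: "Ck_on 2 {0<..} g" and fpos: "\<forall>y>0. 0 < f y"
    and r: "r = (\<lambda>y. g y / f y)"
    and H: "\<forall>y>0. H differentiable (at y) \<and> (deriv H has_real_derivative r y) (at y)"
    and X: "0 < X" and ss: "positive_steady_state f g X h"
  shows "steady_state X H (deriv H) r (deriv r) ((deriv ^^ 2) r) h (deriv h) ((deriv ^^ 2) h)"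
proof -
  define h1 where "h1 = deriv h"
  define h2 where "h2 = (deriv ^^ 2) h"
  define h3 where "h3 = (deriv ^^ 3) h"
  have eqs: "deriv h1 = h2" "deriv h2 = h3"
    by (simp_all add: h1_def h2_def h3_def numeral_2_eq_2 numeral_3_eq_3)
  have C4: "Ck_on 4 UNIV h" and per: "periodic_fun_simple h X" and pos: "\<And>x. 0 < h x"
    and eq: "\<And>x. ((\<lambda>y. f (h y) * h3 y + g (h y) * h1 y) has_real_derivative 0) (at x)"
    using ss by (auto simp: positive_steady_state_def h1_def h3_def)
  have dh: "(h has_real_derivative h1 x) (at x)" "(h1 has_real_derivative h2 x) (at x)"
    "(h2 has_real_derivative h3 x) (at x)" for x
    using C4 eqs unfolding h1_def
    by (auto simp: Ck_on_Suc eval_nat_numeral DERIV_deriv_iff_real_differentiable)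
  have dH: "(H has_real_derivative deriv H y) (at y)" "(deriv H has_real_derivative r y) (at y)"
    if "0 < y" for y
    using H that by (auto simp: DERIV_deriv_iff_real_differentiable)
  define c where "c = f (h 0) * h3 0 + g (h 0) * h1 0"
  have c: "f (h x) * h3 x + g (h x) * h1 x = c" for x
    unfolding c_def using eq by (intro DERIV_isconst_all) blast
  have fh: "f (h x) \<noteq> 0" for x using fpos pos[of x] by force
  have dPhi: "((\<lambda>x. h2 x + deriv H (h x)) has_real_derivative h3 x + r (h x) * h1 x) (at x)" for x
    by (intro DERIV_add dh DERIV_chain2[OF dH(2)[OF pos] dh(1)])
  have phi: "h3 x + r (h x) * h1 x = c / f (h x)" for x
    using c[of x] fh[of x] by (simp add: r field_simps)
  have per2: "periodic_fun_simple h2 X"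
    by (rule periodic_deriv[OF periodic_deriv[OF per dh(1)] dh(2)])
  have "periodic_fun_simple (\<lambda>x. h2 x + deriv H (h x)) X"
    using periodic_funD[OF per] periodic_funD[OF per2] by (intro periodic_funI) simp
  from Rolle_periodic[OF X this dPhi] obtain z where "h3 z + r (h z) * h1 z = 0" by metis
  then have "c = 0" using phi[of z] fh[of z] by simp
  then have h3: "h3 x = - (r (h x) * h1 x)" for x using phi[of x] by simp
  show ?thesis
    unfolding h1_def[symmetric] h2_def[symmetric]
    by unfold_locales
       (use X dH quotient_derivatives[OF f g fpos r] dh[unfolded h3] periodic_funD[OF per] pos in auto)
qed

theorem theorem1:
  fixes f g r H h :: "real \<Rightarrow> real" and X :: real
  assumes "Ck_on 2 {0<..} f" and "Ck_on 2 {0<..} g"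
    and "\<forall>y>0. 0 < f y"
    and "r = (\<lambda>y. g y / f y)"
    and "\<forall>y>0. H differentiable (at y) \<and> (deriv H has_real_derivative r y) (at y)"
    and "0 < X"
    and "positive_steady_state f g X h"
  shows "(linearly_unstable r X h \<longrightarrow> energy_unstable H X h) \<and>
         (\<not> h constant_on UNIV \<and>
            ((\<exists>j::nat. j \<ge> 2 \<and> least_period h (X / real j)) \<or>
             (convex_on {0<..} r \<and> \<not> r constant_on range h))
          \<longrightarrow> energy_unstable H X h) \<and>
         (\<not> h constant_on UNIV \<and> (\<forall>y>0. 0 < (deriv ^^ 2) r y) \<longrightarrow>
          (\<forall>u \<in> {deriv h, \<lambda>x. - deriv h x, (deriv ^^ 2) h, \<lambda>x. - (deriv ^^ 2) h x}.
             energy_unstable_in_direction H X h u))"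
proof -
  interpret steady_state X H "deriv H" r "deriv r" "(deriv ^^ 2) r" h "deriv h" "(deriv ^^ 2) h"
    using assms by (rule positive_steady_state_locale)
  have several: "energy_unstable H X h"
    if nc: "\<not> h constant_on UNIV" and j: "2 \<le> j" and lp: "least_period h (X / real j)" for j :: nat
  proof -
    have p: "periodic_fun_simple h (X / real j)" using lp by (simp add: least_period_def)
    obtain x0 where "deriv h x0 \<noteq> 0" using h1_nonzero[OF nc] .
    moreover have "0 < X / real j" using X j by simp
    moreover have "periodic_fun_simple (\<lambda>x. r (h x)) (X / real j)"
      using periodic_funD[OF p] by (intro periodic_funI) simp
    \<comment> \<open>Here \<open>K\<close>, \<open>k\<close> and \<open>k1\<close> are
      \<open>h\<close>, \<open>h'\<close> and \<open>h''\<close>: the equation for \<open>k\<close>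
      is the linearised one, and the primitive \<open>K\<close> is periodic because \<open>h\<close>
      is.\<close>
    ultimately have "\<exists>\<phi>. negative_direction (real j * (X / real j)) (\<lambda>x. r (h x)) \<phi>"
      using j p by (intro negative_direction_several_periods[OF _ _ cont(6) _ dh dh1 dh2])
    moreover have "real j * (X / real j) = X" using j by simp
    ultimately show ?thesis using energy_unstable_of_negative_direction by metis
  qed
  have convex: "energy_unstable H X h" if "convex_on {0<..} r" "\<not> r constant_on range h"
    using convex_on_second_derivative_nonneg[OF that(1) dr dr1] that(2)
    by (intro energy_unstable_convex) auto
  have directions: "energy_unstable_in_direction H X h u"
    if "\<not> h constant_on UNIV" "\<forall>y>0. 0 < (deriv ^^ 2) r y"
      "u \<in> {deriv h, \<lambda>x. - deriv h x, (deriv ^^ 2) h, \<lambda>x. - (deriv ^^ 2) h x}" for u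
    using energy_unstable_h1[OF that(1,2), of 1] energy_unstable_h1[OF that(1,2), of "-1"]
      energy_unstable_h2[OF that(1,2), of 1] energy_unstable_h2[OF that(1,2), of "-1"] that(3)
    by auto
  show ?thesis
    using energy_unstable_of_linearly_unstable several convex directions by blast
qed

end
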